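(* Let $F$ be a graph with chromatic number $\chi(F)=k+1$, where $k\ge r\ge 2$. Then \[ \mathrm{ex}^{lin}_q(n,F^r)=\frac{2n}{r-1}\left(1-\frac1k\right)+o(n)\quad (n\to\infty). \]
   Context: An $r$-uniform hypergraph is linear if any two distinct edges share at most one vertex; $d_H(v)$ is the number of edges containing $v$. Its signless Laplacian spectral radius is $q(H)=\max_{\|\mathbf{x}\|_r=1}\big(\sum_{v}d_H(v)x_v^r + r\sum_{e\in E(H)}\prod_{v\in e}x_v\big)$ with $\|\mathbf{x}\|_r=(\sum_v|x_v|^r)^{1/r}$. For a graph $F$, the $r$-expansion $F^r$ is the $r$-uniform hypergraph obtained from $F$ by enlarging each edge with $r-2$ new vertices, disjoint from $V(F)$, distinct edges getting distinct new vertices. $\mathrm{ex}^{lin}_q(n,F^r)$ is the maximum of $q(H)$ over all linear $r$-uniform hypergraphs $H$ on $n$ vertices containing no sub-hypergraph isomorphic to $F^r$. *)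

theory Defs
  imports Complex_Main "HOL-Library.Landau_Symbols"
begin

definition simple_graph :: "'a set \<Rightarrow> 'a set set \<Rightarrow> bool" where
  "simple_graph V E \<longleftrightarrow> finite V \<and> (\<forall>e\<in>E. e \<subseteq> V \<and> card e = 2)"

definition proper_colouring :: "'a set \<Rightarrow> 'a set set \<Rightarrow> ('a \<Rightarrow> nat) \<Rightarrow> nat \<Rightarrow> bool" where
  "proper_colouring V E c k \<longleftrightarrow>
     (\<forall>v\<in>V. c v < k) \<and> (\<forall>e\<in>E. \<forall>u\<in>e. \<forall>v\<in>e. u \<noteq> v \<longrightarrow> c u \<noteq> c v)"

definition chromatic_number :: "'a set \<Rightarrow> 'a set set \<Rightarrow> nat" where
  "chromatic_number V E = (LEAST k. \<exists>c. proper_colouring V E c k)"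

definition uniform_hypergraph :: "nat \<Rightarrow> nat \<Rightarrow> nat set set \<Rightarrow> bool" where
  "uniform_hypergraph n r H \<longleftrightarrow> (\<forall>e\<in>H. e \<subseteq> {..<n} \<and> card e = r)"

definition linear_hypergraph :: "nat set set \<Rightarrow> bool" where
  "linear_hypergraph H \<longleftrightarrow> (\<forall>e\<in>H. \<forall>f\<in>H. e \<noteq> f \<longrightarrow> card (e \<inter> f) \<le> 1)"

definition hdeg :: "nat set set \<Rightarrow> nat \<Rightarrow> nat" where
  "hdeg H v = card {e\<in>H. v \<in> e}"

definition q_form :: "nat \<Rightarrow> nat \<Rightarrow> nat set set \<Rightarrow> (nat \<Rightarrow> real) \<Rightarrow> real" where
  "q_form n r H x = (\<Sum>v<n. real (hdeg H v) * x v ^ r) + real r * (\<Sum>e\<in>H. \<Prod>v\<in>e. x v)"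

text \<open>Signless Laplacian spectral radius q(H) (maximum over the unit r-norm sphere;
  the maximum exists by compactness, so it equals the supremum).\<close>
definition signless_q :: "nat \<Rightarrow> nat \<Rightarrow> nat set set \<Rightarrow> real" where
  "signless_q n r H = Sup {q_form n r H x | x. (\<Sum>v<n. \<bar>x v\<bar> ^ r) = 1}"

definition contains_expansion :: "'a set \<Rightarrow> 'a set set \<Rightarrow> nat set set \<Rightarrow> bool" where
  "contains_expansion V E H \<longleftrightarrow>
     (\<exists>(\<phi>::'a \<Rightarrow> nat) (g::'a set \<Rightarrow> nat set). inj_on \<phi> V \<and> inj_on g E \<and>
        (\<forall>e\<in>E. g e \<in> H \<and> \<phi> ` e \<subseteq> g e \<and> (g e - \<phi> ` e) \<inter> \<phi> ` V = {}) \<and>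
        (\<forall>e\<in>E. \<forall>e'\<in>E. e \<noteq> e' \<longrightarrow> (g e - \<phi> ` e) \<inter> (g e' - \<phi> ` e') = {}))"

definition ex_lin_q :: "nat \<Rightarrow> 'a set \<Rightarrow> 'a set set \<Rightarrow> nat \<Rightarrow> real" where
  "ex_lin_q r V E n = Sup {signless_q n r H | H.
      uniform_hypergraph n r H \<and> linear_hypergraph H \<and> \<not> contains_expansion V E H}"

end

(*
  Upper bound. By AM-GM on the pairs inside an edge, with y_v = |x_v|^(r/2), the form of a linear
  hypergraph H is at most 1/(r-1) times the signless Laplacian form of its shadow graph. By
  linearity, a complete (k+1)-partite graph with large parts in the shadow yields an expansion of
  F, the vertices being chosen greedily. So the shadow has no such subgraph, and by Erdos's theorem
  almost all samples of m vertices span no (k+1)-clique. On those samples a weighted Zykov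
  symmetrisation bounds the form by its value on complete k-partite graphs; averaging over the
  samples gives (2(1-1/k)+o(1))n for the shadow.

  Lower bound. A linear hypergraph whose edges are transversal to k parts has a k-partite shadow,
  hence contains no expansion of F. It remains to cover almost all pairs of vertices in different
  parts, for which an explicit algebraic packing over the residues modulo q is used, and to test
  the form on the constant vector.
*)
theory Submission
  imports Defs "HOL-Analysis.Analysis" "HOL-Number_Theory.Cong"
begin

section \<open>Clique-free graphs\<close>

text \<open>Counting the edges of the shadow would not be enough, since the vector may weight the
  vertices arbitrarily. The weighted symmetrisation has no error term: on a clique-free sample of m
  vertices the form is at most 4(1 - 1/k)m times the squared norm, with 4 in place of 2 because the
  double sums run over ordered pairs. All losses come from the sampling. Samples that do contain a
  clique are rare but can only be bounded trivially, which is cheap only while every squared weight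
  is O(1/n). AM-GM costs nothing in the limit, since constant vectors give equality in every edge.

  In the lower bound an edge meets r different parts, whence r \<le> k. The obstacle there is that
  two parts lie in (k-2 choose r-2) common r-sets of parts, whose edges compete for the same vertex
  pairs. The packing has to split these pairs into equal shares, for all pairs of parts
  simultaneously. It works for every q coprime to k!, in particular for q = 1 modulo k!, and such q
  occur with bounded gaps.\<close>

lemma sum_lessThan_Suc_square:
  fixes g :: "nat \<Rightarrow> nat \<Rightarrow> real"
  assumes "\<And>i j. g i j = g j i" and "g k k = 0"
  shows "(\<Sum>i<Suc k. \<Sum>j<Suc k. g i j) = (\<Sum>i<k. \<Sum>j<k. g i j) + 2 * (\<Sum>i<k. g i k)"
proof -
  have "(\<Sum>i<Suc k. \<Sum>j<Suc k. g i j) = (\<Sum>i<k. (\<Sum>j<k. g i j) + g i k) + ((\<Sum>j<k. g k j) + g k k)"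
    by simp
  also have "(\<Sum>j<k. g k j) = (\<Sum>i<k. g i k)"
    using assms(1) by (intro sum.cong) auto
  finally show ?thesis using assms(2) by (simp add: sum.distrib)
qed

text \<open>\<open>N\<close> will be the neighbourhood of the vertex that is cloned. Pairs inside
  \<open>V - N\<close> are counted twice on the right. This is harmless: each row of
  \<open>V - N\<close> will then be replaced by the row of the cloned vertex, which vanishes outside
  \<open>N\<close>.\<close>

lemma sum_square_split:
  fixes g :: "'v \<Rightarrow> 'v \<Rightarrow> real"
  assumes "finite V" "N \<subseteq> V" and sym: "\<And>u v. g u v = g v u" and nn: "\<And>u v. 0 \<le> g u v"
  shows "(\<Sum>u\<in>V. \<Sum>v\<in>V. g u v) \<le> (\<Sum>u\<in>N. \<Sum>v\<in>N. g u v) + 2 * (\<Sum>u\<in>V-N. \<Sum>v\<in>V. g u v)"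
proof -
  let ?W = "V - N"
  have fin: "finite N" "finite ?W" using assms(1,2) finite_subset by auto
  have sp: "(\<Sum>v\<in>V. h v) = (\<Sum>v\<in>N. h v) + (\<Sum>v\<in>?W. h v)" for h :: "'v \<Rightarrow> real"
    using sum.subset_diff[OF assms(2,1), of h] by simp
  have "(\<Sum>u\<in>V. \<Sum>v\<in>V. g u v) = (\<Sum>u\<in>N. \<Sum>v\<in>N. g u v) + (\<Sum>u\<in>N. \<Sum>v\<in>?W. g u v) + (\<Sum>u\<in>?W. \<Sum>v\<in>V. g u v)"
    by (subst sp) (simp add: sp sum.distrib)
  moreover have "(\<Sum>u\<in>N. \<Sum>v\<in>?W. g u v) = (\<Sum>u\<in>?W. \<Sum>v\<in>N. g u v)"
    by (subst sum.swap) (simp add: sym)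
  moreover have "(\<Sum>u\<in>?W. \<Sum>v\<in>N. g u v) \<le> (\<Sum>u\<in>?W. \<Sum>v\<in>V. g u v)"
    by (intro sum_mono sum_mono2 nn assms(1,2))
  ultimately show ?thesis by simp
qed

text \<open>Zykov symmetrisation with weights: all non-neighbours of a vertex \<open>v\<close> of largest contribution become
  clones of \<open>v\<close>, weight included. The potential \<open>h\<close> is arbitrary so that the contribution
  of these clones to the neighbourhood of \<open>v\<close> can be absorbed into it before recursing.\<close>

lemma clique_free_le_multipartite:
  fixes f :: "real \<Rightarrow> real \<Rightarrow> real" and x :: "'v \<Rightarrow> real" and h :: "real \<Rightarrow> real"
  assumes fsym: "\<And>s t. f s t = f t s" and fnn: "\<And>s t. 0 \<le> f s t"
    and asym: "\<And>u v. adj u v = adj v u" and irr: "\<And>u. \<not> adj u u"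
  assumes "finite V" "\<not> (\<exists>C\<subseteq>V. card C = Suc k \<and> pairwise adj C)"
  shows "\<exists>(N :: nat \<Rightarrow> nat) y. (\<Sum>i<k. N i) = card V \<and>
    (\<Sum>u\<in>V. \<Sum>v\<in>V. of_bool (adj u v) * f (x u) (x v)) + 2 * (\<Sum>v\<in>V. h (x v)) \<le>
    (\<Sum>i<k. \<Sum>j<k. of_bool (i \<noteq> j) * real (N i) * real (N j) * f (y i) (y j)) + 2 * (\<Sum>i<k. real (N i) * h (y i))"
  using assms(5,6)
proof (induction k arbitrary: V h)
  case 0
  have "V = {}"
  proof (rule ccontr)
    assume "V \<noteq> {}"
    then obtain v where "v \<in> V" by auto
    then show False using 0(2) by (auto dest!: spec[of _ "{v}"])
  qed
  then show ?case by auto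
next
  case (Suc k)
  define g where "g u v = of_bool (adj u v) * f (x u) (x v)" for u v
  have gs: "g u v = g v u" and gn: "0 \<le> g u v" for u v
    using fsym fnn asym by (auto simp: g_def)
  show ?case
  proof (cases "V = {}")
    case True
    then show ?thesis by (intro exI[of _ "\<lambda>_. 0"]) auto
  next
    case False
    define \<phi> where "\<phi> u = (\<Sum>w\<in>V. g u w) + h (x u)" for u
    obtain v where v: "v \<in> V" and vmax: "\<And>u. u \<in> V \<Longrightarrow> \<phi> u \<le> \<phi> v"
    proof -
      have "Max (\<phi> ` V) \<in> \<phi> ` V" using Suc.prems(1) False by (intro Max_in) auto
      then obtain v where "v \<in> V" "\<phi> v = Max (\<phi> ` V)" by auto
      then show ?thesis using that[of v] Suc.prems(1) by auto
    qed
    define N where "N = {w\<in>V. adj v w}"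
    define W where "W = V - N"
    have NV: "N \<subseteq> V" and finN: "finite N" using Suc.prems(1) by (auto simp: N_def)
    \<comment> \<open>The \<open>card W\<close> clones of \<open>v\<close> interact with a neighbour
      of weight \<open>t\<close> through \<open>f (x v) t\<close>, in both orders; the factor 2 in
      front of the potential supplies the second order.\<close>
    define h' where "h' t = h t + real (card W) * f (x v) t" for t
    have "\<not> (\<exists>C\<subseteq>N. card C = Suc k \<and> pairwise adj C)"
    proof
      assume "\<exists>C\<subseteq>N. card C = Suc k \<and> pairwise adj C"
      then obtain C where C: "C \<subseteq> N" "card C = Suc k" "pairwise adj C" by blast
      have "v \<notin> C" "finite C" using C(1) irr finN finite_subset by (auto simp: N_def)
      then have "insert v C \<subseteq> V \<and> card (insert v C) = Suc (Suc k) \<and> pairwise adj (insert v C)"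
        using C v NV asym by (auto simp: pairwise_insert N_def subset_iff)
      then show False using Suc.prems(2) by blast
    qed
    from Suc.IH[OF finN this, of h'] obtain M y where M: "(\<Sum>i<k. M i) = card N"
      and le: "(\<Sum>u\<in>N. \<Sum>v\<in>N. g u v) + 2 * (\<Sum>v\<in>N. h' (x v)) \<le>
        (\<Sum>i<k. \<Sum>j<k. of_bool (i \<noteq> j) * real (M i) * real (M j) * f (y i) (y j)) + 2 * (\<Sum>i<k. real (M i) * h' (y i))"
      unfolding g_def by auto
    define M' where "M' = M(k := card W)"
    define y' where "y' = y(k := x v)"
    have c: "card N + card W = card V"
      unfolding W_def using NV Suc.prems(1) by (metis card_Diff_subset card_mono finN le_add_diff_inverse)
    have 1: "(\<Sum>i<Suc k. M' i) = card V"
      using M c by (simp add: M'_def)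
    have gv: "(\<Sum>w\<in>V. g v w) = (\<Sum>w\<in>N. f (x v) (x w))"
      unfolding N_def g_def using sum.inter_filter[OF Suc.prems(1), of "\<lambda>w. f (x v) (x w)" "adj v"]
      by (simp add: if_distrib if_distribR of_bool_def cong: if_cong)
    have "(\<Sum>u\<in>V. \<Sum>v\<in>V. g u v) + 2 * (\<Sum>v\<in>V. h (x v)) \<le>
        (\<Sum>u\<in>N. \<Sum>v\<in>N. g u v) + 2 * (\<Sum>u\<in>W. \<Sum>v\<in>V. g u v) + 2 * (\<Sum>v\<in>V. h (x v))"
      using sum_square_split[OF Suc.prems(1) NV gs gn] by (simp add: W_def)
    also have "\<dots> = (\<Sum>u\<in>N. \<Sum>v\<in>N. g u v) + 2 * (\<Sum>u\<in>W. \<Sum>v\<in>V. g u v) + 2 * ((\<Sum>v\<in>N. h (x v)) + (\<Sum>v\<in>W. h (x v)))"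
      unfolding W_def using sum.subset_diff[OF NV Suc.prems(1), of "\<lambda>v. h (x v)"] by simp
    also have "(\<Sum>u\<in>N. \<Sum>v\<in>N. g u v) + 2 * (\<Sum>u\<in>W. \<Sum>v\<in>V. g u v) + 2 * ((\<Sum>v\<in>N. h (x v)) + (\<Sum>v\<in>W. h (x v)))
       = (\<Sum>u\<in>N. \<Sum>v\<in>N. g u v) + 2 * (\<Sum>v\<in>N. h (x v)) + 2 * (\<Sum>u\<in>W. \<phi> u)"
      by (simp add: \<phi>_def sum.distrib)
    also have "\<dots> \<le> (\<Sum>u\<in>N. \<Sum>v\<in>N. g u v) + 2 * (\<Sum>v\<in>N. h (x v)) + 2 * (real (card W) * \<phi> v)"
      using vmax by (intro add_left_mono mult_left_mono sum_bounded_above) (auto simp: W_def)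
    also have "(\<Sum>u\<in>N. \<Sum>v\<in>N. g u v) + 2 * (\<Sum>v\<in>N. h (x v)) + 2 * (real (card W) * \<phi> v)
       = (\<Sum>u\<in>N. \<Sum>v\<in>N. g u v) + 2 * (\<Sum>v\<in>N. h' (x v)) + 2 * real (card W) * h (x v)"
      by (simp add: \<phi>_def gv h'_def sum.distrib sum_distrib_left algebra_simps)
    also have "\<dots> \<le> (\<Sum>i<k. \<Sum>j<k. of_bool (i \<noteq> j) * real (M i) * real (M j) * f (y i) (y j))
       + 2 * (\<Sum>i<k. real (M i) * h' (y i)) + 2 * real (card W) * h (x v)"
      using le by simp
    also have "\<dots> = (\<Sum>i<Suc k. \<Sum>j<Suc k. of_bool (i \<noteq> j) * real (M' i) * real (M' j) * f (y' i) (y' j))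
       + 2 * (\<Sum>i<Suc k. real (M' i) * h (y' i))"
      by (subst sum_lessThan_Suc_square)
         (auto simp: fsym M'_def y'_def h'_def sum.distrib sum_distrib_left algebra_simps)
    finally have "(\<Sum>u\<in>V. \<Sum>v\<in>V. g u v) + 2 * (\<Sum>v\<in>V. h (x v)) \<le>
       (\<Sum>i<Suc k. \<Sum>j<Suc k. of_bool (i \<noteq> j) * real (M' i) * real (M' j) * f (y' i) (y' j))
       + 2 * (\<Sum>i<Suc k. real (M' i) * h (y' i))" .
    with 1 show ?thesis unfolding g_def by blast
  qed
qed

text \<open>With \<open>n\<close>, \<open>A\<close>, \<open>S\<close>, \<open>Q\<close> as in the
  proof the form equals 2nA + 2S^2 - 4Q. Cauchy-Schwarz over the parts gives S^2 \<le> kQ, and over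
  the vertices S^2 \<le> nA. Eliminating Q leaves S^2 with the coefficient 2(1 - 2/k), which is
  nonnegative for k \<ge> 2, so the second inequality applies. Equal parts with constant weights
  attain the bound.\<close>

lemma multipartite_q_form_le:
  fixes N :: "nat \<Rightarrow> nat" and y :: "nat \<Rightarrow> real"
  assumes "2 \<le> k"
  shows "(\<Sum>i<k. \<Sum>j<k. of_bool (i \<noteq> j) * real (N i) * real (N j) * (y i + y j)^2)
    \<le> 4 * (1 - 1 / real k) * real (\<Sum>i<k. N i) * (\<Sum>i<k. real (N i) * (y i)^2)"
proof -
  define n where "n = (\<Sum>i<k. real (N i))"
  define A where "A = (\<Sum>i<k. real (N i) * (y i)^2)"
  define S where "S = (\<Sum>i<k. real (N i) * y i)"
  define Q where "Q = (\<Sum>i<k. (real (N i) * y i)^2)"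
  have "(\<Sum>i<k. \<Sum>j<k. of_bool (i \<noteq> j) * real (N i) * real (N j) * (y i + y j)^2)
     = (\<Sum>i<k. \<Sum>j<k. real (N i) * real (N j) * (y i + y j)^2 - (if i = j then 4 * (real (N i) * y i)^2 else 0))"
    by (intro sum.cong refl) (auto simp: power2_eq_square algebra_simps)
  also have "\<dots> = (\<Sum>i<k. \<Sum>j<k. real (N i) * real (N j) * (y i + y j)^2) - 4 * Q"
    by (simp add: sum_subtractf Q_def sum_distrib_left)
  also have "(\<Sum>i<k. \<Sum>j<k. real (N i) * real (N j) * (y i + y j)^2) =
     (\<Sum>i<k. \<Sum>j<k. (real (N i) * (y i)^2) * real (N j)) + (\<Sum>i<k. \<Sum>j<k. real (N i) * (real (N j) * (y j)^2))
      + 2 * (\<Sum>i<k. \<Sum>j<k. (real (N i) * y i) * (real (N j) * y j))"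
    unfolding sum_distrib_left sum.distrib[symmetric]
    by (intro sum.cong refl) (simp add: power2_eq_square algebra_simps)
  also have "\<dots> = 2 * n * A + 2 * S^2"
    unfolding sum_product[symmetric] n_def[symmetric] A_def[symmetric] S_def[symmetric]
    by (simp add: power2_eq_square)
  finally have eq: "(\<Sum>i<k. \<Sum>j<k. of_bool (i \<noteq> j) * real (N i) * real (N j) * (y i + y j)^2) = 2 * n * A + 2 * S^2 - 4 * Q" .
  have "S^2 \<le> (\<Sum>i<k. 1^2) * Q"
    unfolding S_def Q_def using Cauchy_Schwarz_ineq_sum[of "\<lambda>_. 1" "\<lambda>i. real (N i) * y i" "{..<k}"] by simp
  then have SQ: "S^2 \<le> real k * Q" by simp
  have Sn: "S^2 \<le> n * A"
    unfolding S_def n_def A_def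
    using Cauchy_Schwarz_ineq_sum[of "\<lambda>i. sqrt (real (N i))" "\<lambda>i. sqrt (real (N i)) * y i" "{..<k}"]
    by (simp add: power_mult_distrib mult.assoc[symmetric])
  define \<kappa> where "\<kappa> = 1 / real k"
  have "0 \<le> (n * A - S^2) * (1 - 2 * \<kappa>)"
    using assms Sn by (intro mult_nonneg_nonneg) (auto simp: \<kappa>_def)
  also have "\<dots> = n * A - S^2 - 2 * (n * A * \<kappa>) + 2 * (S^2 * \<kappa>)"
    by (simp only: left_diff_distrib right_diff_distrib)
  finally have "0 \<le> n * A - S^2 - 2 * (n * A * \<kappa>) + 2 * (S^2 * \<kappa>)" .
  moreover have "S^2 * \<kappa> \<le> Q"
    using SQ assms by (simp add: field_simps \<kappa>_def)
  moreover have "4 * (1 - \<kappa>) * n * A = 4 * (n * A) - 4 * (n * A * \<kappa>)"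
    by (simp add: algebra_simps)
  ultimately have "2 * n * A + 2 * S^2 - 4 * Q \<le> 4 * (1 - \<kappa>) * n * A"
    by linarith
  then show ?thesis unfolding eq by (simp add: n_def A_def \<kappa>_def)
qed

lemma clique_free_q_form_le:
  fixes x :: "'v \<Rightarrow> real"
  assumes "\<And>u v. adj u v = adj v u" and "\<And>u. \<not> adj u u"
  assumes "finite V" "\<not> (\<exists>C\<subseteq>V. card C = Suc k \<and> pairwise adj C)" "2 \<le> k"
  shows "(\<Sum>u\<in>V. \<Sum>v\<in>V. of_bool (adj u v) * (x u + x v)^2)
    \<le> 4 * (1 - 1 / real k) * real (card V) * (\<Sum>v\<in>V. (x v)^2)"
proof -
  \<comment> \<open>Symmetrisation changes the squared norm, so a Rayleigh quotient cannot be
    followed through it. The potential \<open>- c * t^2\<close> acts as a Lagrange multiplier: the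
    form minus \<open>2 * c\<close> times the squared norm is what symmetrisation does not decrease,
    and it is at most 0 on multipartite graphs.\<close>
  define c where "c = 2 * (1 - 1 / real k) * real (card V)"
  obtain N y where N: "(\<Sum>i<k. N i) = card V" and
    le: "(\<Sum>u\<in>V. \<Sum>v\<in>V. of_bool (adj u v) * (x u + x v)^2) + 2 * (\<Sum>v\<in>V. - c * (x v)^2) \<le>
    (\<Sum>i<k. \<Sum>j<k. of_bool (i \<noteq> j) * real (N i) * real (N j) * (y i + y j)^2) + 2 * (\<Sum>i<k. real (N i) * (- c * (y i)^2))"
    using clique_free_le_multipartite[of "\<lambda>s t. (s + t)^2" adj V k x "\<lambda>t. - c * t^2"] assms
    by (auto simp: add.commute)
  have eq: "(\<Sum>i<k. real (N i) * (- c * (y i)^2)) = - c * (\<Sum>i<k. real (N i) * (y i)^2)"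
    unfolding sum_distrib_left by (intro sum.cong) auto
  have "2 * c * (\<Sum>i<k. real (N i) * (y i)^2) =
    4 * (1 - 1 / real k) * real (card V) * (\<Sum>i<k. real (N i) * (y i)^2)"
    by (simp add: c_def)
  then have "(\<Sum>u\<in>V. \<Sum>v\<in>V. of_bool (adj u v) * (x u + x v)^2) + 2 * (\<Sum>v\<in>V. - c * (x v)^2) \<le> 0"
    using le multipartite_q_form_le[OF assms(5), of N y] unfolding N eq by linarith
  then show ?thesis unfolding sum_distrib_left[symmetric] c_def by (simp add: algebra_simps)
qed

section \<open>Boxes in dense relations\<close>

lemma exists_popular_element:
  fixes D :: "'y \<Rightarrow> nat set"
  assumes "finite Y" "finite U" "\<And>y. y \<in> Y \<Longrightarrow> D y \<subseteq> U \<and> c * real (card U) \<le> real (card (D y))"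
    and "U \<noteq> {}"
  shows "\<exists>v\<in>U. c * real (card Y) \<le> real (card {y\<in>Y. v \<in> D y})"
proof (rule ccontr)
  assume "\<not> ?thesis"
  then have "(\<Sum>v\<in>U. real (card {y\<in>Y. v \<in> D y})) < (\<Sum>v\<in>U. c * real (card Y))"
    using assms(2,4) by (intro sum_strict_mono) auto
  also have "\<dots> = (\<Sum>y\<in>Y. c * real (card U))" by simp
  also have "\<dots> \<le> (\<Sum>y\<in>Y. real (card (D y)))" using assms(3) by (intro sum_mono) auto
  also have "\<dots> = (\<Sum>y\<in>Y. \<Sum>v\<in>U. of_bool (v \<in> D y))"
  proof (intro sum.cong refl)
    fix y assume "y \<in> Y"
    then have "U \<inter> D y = D y" using assms(3) by auto
    then show "real (card (D y)) = (\<Sum>v\<in>U. of_bool (v \<in> D y))" using assms(2) by (simp add: Int_def)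
  qed
  also have "\<dots> = (\<Sum>v\<in>U. \<Sum>y\<in>Y. of_bool (v \<in> D y))" by (rule sum.swap)
  also have "\<dots> = (\<Sum>v\<in>U. real (card {y\<in>Y. v \<in> D y}))" 
    using assms(1) by (simp add: Int_def)
  finally show False by simp
qed

text \<open>The elements of \<open>A\<close> are picked one at a time, each keeping at least the
  fraction \<open>c\<close> of the remaining \<open>y\<close>. A picked element is deleted from the
  sets \<open>D y\<close>, which is paid for by the summand \<open>T\<close>. For empty
  \<open>Y\<close> nothing guarantees that \<open>{..<n}\<close> has \<open>T\<close> elements,
  hence the guard on the cardinality.\<close>

lemma exists_popular_set:
  fixes D :: "'y \<Rightarrow> nat set" and c :: real
  assumes "finite Y" "0 < c" "\<And>y. y \<in> Y \<Longrightarrow> D y \<subseteq> {..<n} \<and> c * real n + real T \<le> real (card (D y))"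
  shows "n > 0 \<Longrightarrow> \<exists>A\<subseteq>{..<n}. (Y \<noteq> {} \<longrightarrow> card A = T) \<and> c ^ T * real (card Y) \<le> real (card {y\<in>Y. A \<subseteq> D y})"
  using assms
proof (induction T arbitrary: D Y)
  case 0
  then show ?case by (intro exI[of _ "{}"]) auto
next
  case (Suc T)
  have "c * real (card {..<n}) \<le> real (card (D y))" if "y \<in> Y" for y
    using Suc.prems(4)[OF that] by simp
  then obtain v where v: "v < n" "c * real (card Y) \<le> real (card {y\<in>Y. v \<in> D y})"
    using exists_popular_element[of Y "{..<n}" D c] Suc.prems by auto
  define Y' where "Y' = {y\<in>Y. v \<in> D y}"
  have "finite Y'" using Suc.prems(2) by (simp add: Y'_def)
  moreover have "D y - {v} \<subseteq> {..<n} \<and> c * real n + real T \<le> real (card (D y - {v}))" if "y \<in> Y'" for y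
  proof -
    have "finite (D y)" "v \<in> D y" "D y \<subseteq> {..<n}" "c * real n + real (Suc T) \<le> real (card (D y))"
      using that Suc.prems(4)[of y] finite_subset by (auto simp: Y'_def)
    then show ?thesis by (auto simp: card_Diff_singleton)
  qed
  ultimately obtain A where A: "A \<subseteq> {..<n}" "Y' \<noteq> {} \<longrightarrow> card A = T"
    "c ^ T * real (card Y') \<le> real (card {y\<in>Y'. A \<subseteq> D y - {v}})"
    using Suc.IH[of Y' "\<lambda>y. D y - {v}"] Suc.prems(1,3) by auto
  show ?case
  proof (cases "Y = {}")
    case False
    then have "card Y > 0" using Suc.prems(2) by (simp add: card_gt_0_iff)
    then have "c ^ T * (c * real (card Y)) \<le> c ^ T * real (card Y')" "0 < c ^ T * (c * real (card Y))"
      using v(2) \<open>0 < c\<close> by (auto simp: Y'_def)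
    then have le: "c ^ Suc T * real (card Y) \<le> real (card {y\<in>Y'. A \<subseteq> D y - {v}})"
      and pos: "card {y\<in>Y'. A \<subseteq> D y - {v}} > 0"
      using A(3) by (auto simp: mult_ac intro: gr0I)
    then obtain y where y: "y \<in> Y'" "A \<subseteq> D y - {v}" by (metis (mono_tags, lifting) Collect_empty_eq card.empty less_irrefl)
    have "card {y\<in>Y'. A \<subseteq> D y - {v}} \<le> card {y\<in>Y. insert v A \<subseteq> D y}"
      using Suc.prems(2) by (intro card_mono) (auto simp: Y'_def)
    moreover have "card (insert v A) = Suc T"
      using A y finite_subset[OF A(1)] by (subst card_insert_disjoint) auto
    ultimately show ?thesis using le A(1) v(1)
      by (intro exI[of _ "insert v A"]) auto
  qed auto
qed

text \<open>Samples are ordered and allow repetition, so that sums over them factor coordinate by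
  coordinate and their number is exactly \<open>n ^ m\<close>.\<close>

definition nlists :: "nat \<Rightarrow> nat \<Rightarrow> nat list set" where
  "nlists n m = {xs. set xs \<subseteq> {..<n} \<and> length xs = m}"

lemma finite_nlists: "finite (nlists n m)" and card_nlists: "card (nlists n m) = n ^ m"
  unfolding nlists_def by (simp_all add: finite_lists_length_eq card_lists_length_eq)

lemma nlists_0: "nlists n 0 = {[]}"
  by (auto simp: nlists_def)

lemma sum_nlists_Suc:
  "(\<Sum>xs\<in>nlists n (Suc m). g xs) = (\<Sum>v<n. \<Sum>xs\<in>nlists n m. g (v # xs))"
proof -
  have eq: "nlists n (Suc m) = (\<lambda>(v, xs). v # xs) ` ({..<n} \<times> nlists n m)"
    by (force simp: nlists_def length_Suc_conv image_iff)
  have "(\<Sum>xs\<in>nlists n (Suc m). g xs) = (\<Sum>(v, xs)\<in>{..<n} \<times> nlists n m. g (v # xs))"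
    unfolding eq by (subst sum.reindex) (auto simp: inj_on_def intro!: sum.cong)
  then show ?thesis by (simp add: sum.cartesian_product)
qed

text \<open>A complete partite hypergraph with sides of size \<open>T\<close>, in which the position
  of a vertex tells its side; as sets of vertices the sides may overlap.\<close>

definition contains_box :: "nat \<Rightarrow> nat \<Rightarrow> nat \<Rightarrow> nat list set \<Rightarrow> bool" where
  "contains_box n m T R \<longleftrightarrow> (\<exists>A. (\<forall>i<m. A i \<subseteq> {..<n} \<and> card (A i) = T) \<and>
     (\<forall>xs. length xs = m \<and> (\<forall>i<m. xs ! i \<in> A i) \<longrightarrow> xs \<in> R))"

text \<open>Erdos's theorem that a dense partite uniform hypergraph contains a complete partite one: many
  tails share the same \<open>T\<close> first coordinates, and the induction is on the number of coordinates.\<close>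

theorem dense_relation_contains_box:
  fixes \<delta> :: real
  assumes "0 < \<delta>"
  shows "\<exists>n0. \<forall>n\<ge>n0. \<forall>R\<subseteq>nlists n m. \<delta> * real n ^ m \<le> real (card R) \<longrightarrow>
    contains_box n m T R"
  using assms
proof (induction m arbitrary: \<delta>)
  case 0
  have "contains_box n 0 T R" if "R \<subseteq> nlists n 0" "\<delta> * real n ^ 0 \<le> real (card R)" for n R
  proof -
    have "R \<noteq> {}" using that 0 by auto
    then have "R = {[]}" using that(1) nlists_0 by auto
    then show ?thesis by (simp add: contains_box_def)
  qed
  then show ?case by blast
next
  case (Suc m)
  \<comment> \<open>Tails with at least \<open>\<delta> / 2 * n\<close> first coordinates form at
    least the fraction \<open>\<delta> / 2\<close> of all tails. Half of that supply is the density
    \<open>c\<close> for the popular elements; the other half exceeds \<open>T\<close> for large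
    \<open>n\<close>. The fraction \<open>c ^ T\<close> of these tails survives, which gives
    \<open>\<delta>'\<close>.\<close>
  define c where "c = \<delta> / 4"
  define \<delta>' where "\<delta>' = c ^ T * (\<delta> / 2)"
  have "0 < c" "0 < \<delta>'" using Suc.prems by (auto simp: c_def \<delta>'_def)
  then obtain n1 where n1: "\<And>n R. n \<ge> n1 \<Longrightarrow> R \<subseteq> nlists n m \<Longrightarrow> \<delta>' * real n ^ m \<le> real (card R) \<Longrightarrow>
    contains_box n m T R"
    using Suc.IH[of \<delta>'] by blast
  obtain n2 where n2: "real T \<le> c * real n2"
    using \<open>0 < c\<close> by (metis mult.commute pos_divide_le_eq real_arch_simple)
  show ?case
  proof (intro exI[of _ "max n1 (max n2 1)"] allI impI)
    fix n R
    assume n: "max n1 (max n2 1) \<le> n" and R: "R \<subseteq> nlists n (Suc m)" and big: "\<delta> * real n ^ Suc m \<le> real (card R)"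
    have "c * real n2 \<le> c * real n" using n \<open>0 < c\<close> by simp
    then have nT: "c * real n + real T \<le> \<delta> / 2 * real n" using n2 by (simp add: c_def)
    define D where "D y = {v. v < n \<and> v # y \<in> R}" for y
    define Y where "Y = {y\<in>nlists n m. \<delta> / 2 * real n \<le> real (card (D y))}"
    have finY: "finite Y" using finite_nlists by (simp add: Y_def)
    have "real (card R) = (\<Sum>xs\<in>nlists n (Suc m). of_bool (xs \<in> R))"
    proof -
      have "nlists n (Suc m) \<inter> R = R" using R by blast
      then show ?thesis using finite_nlists[of n "Suc m"] by simp
    qed
    also have "\<dots> = (\<Sum>y\<in>nlists n m. \<Sum>v<n. of_bool (v # y \<in> R))"
      unfolding sum_nlists_Suc by (rule sum.swap)
    also have "\<dots> = (\<Sum>y\<in>nlists n m. real (card (D y)))"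
      by (simp add: D_def Int_def)
    also have "\<dots> \<le> (\<Sum>y\<in>nlists n m. of_bool (y \<in> Y) * real n + \<delta> / 2 * real n)"
    proof (intro sum_mono)
      fix y assume y: "y \<in> nlists n m"
      have "card (D y) \<le> card {..<n}" by (intro card_mono) (auto simp: D_def)
      then have "real (card (D y)) \<le> real n" by simp
      moreover have "0 \<le> \<delta> / 2 * real n" using Suc.prems by simp
      moreover have "real (card (D y)) \<le> \<delta> / 2 * real n" if "y \<notin> Y"
        using that y by (simp add: Y_def)
      ultimately show "real (card (D y)) \<le> of_bool (y \<in> Y) * real n + \<delta> / 2 * real n"
        by (cases "y \<in> Y") auto
    qed
    also have "\<dots> = real (card Y) * real n + \<delta> / 2 * real n * real n ^ m"
    proof -
      have "nlists n m \<inter> Y = Y" by (auto simp: Y_def)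
      then show ?thesis using finite_nlists[of n m]
        by (simp add: sum.distrib sum_distrib_right[symmetric] card_nlists)
    qed
    finally have "(\<delta> / 2 * real n ^ m) * real n \<le> real (card Y) * real n"
      using big by (simp add: mult_ac)
    then have Ybig: "\<delta> / 2 * real n ^ m \<le> real (card Y)"
      using n by simp
    then have "card Y > 0"
    proof -
      have "0 < \<delta> / 2 * real n ^ m" using Suc.prems n by simp
      then have "0 < real (card Y)" using Ybig by linarith
      then show ?thesis by simp
    qed
    then have Yne: "Y \<noteq> {}" by auto
    have "D y \<subseteq> {..<n} \<and> c * real n + real T \<le> real (card (D y))" if "y \<in> Y" for y
      using that nT by (auto simp: D_def Y_def)
    then obtain A0 where A0: "A0 \<subseteq> {..<n}" "card A0 = T"
       "c ^ T * real (card Y) \<le> real (card {y\<in>Y. A0 \<subseteq> D y})"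
      using exists_popular_set[OF finY \<open>0 < c\<close>, of D n T] Yne n by auto
    have "\<delta>' * real n ^ m \<le> c ^ T * real (card Y)"
      using Ybig \<open>0 < c\<close> by (simp add: \<delta>'_def mult.assoc)
    with A0(3) have "\<delta>' * real n ^ m \<le> real (card {y\<in>Y. A0 \<subseteq> D y})" by simp
    moreover have "{y\<in>Y. A0 \<subseteq> D y} \<subseteq> nlists n m" by (auto simp: Y_def)
    ultimately have "contains_box n m T {y\<in>Y. A0 \<subseteq> D y}"
      using n by (intro n1) simp_all
    then obtain A where A: "\<forall>i<m. A i \<subseteq> {..<n} \<and> card (A i) = T"
       "\<forall>xs. length xs = m \<and> (\<forall>i<m. xs ! i \<in> A i) \<longrightarrow> xs \<in> {y\<in>Y. A0 \<subseteq> D y}"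
      unfolding contains_box_def by (elim exE conjE)
    show "contains_box n (Suc m) T R"
      unfolding contains_box_def
    proof (intro exI[of _ "case_nat A0 A"] conjI allI impI)
      fix i assume "i < Suc m"
      then show "case_nat A0 A i \<subseteq> {..<n}" "card (case_nat A0 A i) = T"
        using A0 A(1) by (auto split: nat.split)
    next
      fix xs assume xs: "length xs = Suc m \<and> (\<forall>i<Suc m. xs ! i \<in> case_nat A0 A i)"
      then obtain v ys where vys: "xs = v # ys" "length ys = m" by (auto simp: length_Suc_conv)
      have "v \<in> A0" using xs vys by (auto dest: spec[of _ 0])
      moreover have "ys ! i \<in> A i" if "i < m" for i
        using xs vys that by (auto dest: spec[of _ "Suc i"])
      ultimately have "ys \<in> {y\<in>Y. A0 \<subseteq> D y}" using A(2) vys(2) by blast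
      with \<open>v \<in> A0\<close> show "xs \<in> R" using vys by (auto simp: D_def)
    qed
  qed
qed

section \<open>Graphs without large complete multipartite subgraphs\<close>

text \<open>Each of the \<open>m\<close> coordinates takes each value \<open>n ^ (m - 1)\<close>
  times; the factor \<open>real n\<close> on the left avoids this truncated exponent.\<close>

lemma sum_nlists_marginal:
  fixes f :: "nat \<Rightarrow> real"
  shows "real n * (\<Sum>xs\<in>nlists n m. \<Sum>i<m. f (xs ! i)) = real m * real n ^ m * (\<Sum>v<n. f v)"
proof (induction m)
  case (Suc m)
  have "(\<Sum>xs\<in>nlists n (Suc m). \<Sum>i<Suc m. f (xs ! i)) =
     (\<Sum>v<n. \<Sum>xs\<in>nlists n m. f v + (\<Sum>i<m. f (xs ! i)))"
    unfolding sum_nlists_Suc by (simp add: sum.lessThan_Suc_shift del: sum.lessThan_Suc)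
  also have "\<dots> = real n ^ m * (\<Sum>v<n. f v) + real n * (\<Sum>xs\<in>nlists n m. \<Sum>i<m. f (xs ! i))"
    by (simp add: sum.distrib card_nlists sum_distrib_left)
  also have "\<dots> = real (Suc m) * real n ^ m * (\<Sum>v<n. f v)"
    unfolding Suc.IH by (simp add: algebra_simps)
  finally show ?case by simp
qed simp

text \<open>Two different positions are independent and uniform, and there are m(m-1) ordered pairs
  of them. The m diagonal terms vanish by \<open>diag\<close>.\<close>

lemma sum_nlists_pair_marginal:
  fixes g :: "nat \<Rightarrow> nat \<Rightarrow> real"
  assumes sym: "\<And>u v. g u v = g v u" and diag: "\<And>u. g u u = 0"
  shows "real n ^ 2 * (\<Sum>xs\<in>nlists n m. \<Sum>i<m. \<Sum>j<m. g (xs ! i) (xs ! j)) =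
    real m * (real m - 1) * real n ^ m * (\<Sum>u<n. \<Sum>v<n. g u v)"
proof (induction m)
  case (Suc m)
  define S where "S = (\<Sum>xs\<in>nlists n m. \<Sum>i<m. \<Sum>j<m. g (xs ! i) (xs ! j))"
  define G where "G = (\<Sum>u<n. \<Sum>v<n. g u v)"
  have step: "(\<Sum>i<Suc m. \<Sum>j<Suc m. g ((v # xs) ! i) ((v # xs) ! j)) =
     2 * (\<Sum>j<m. g v (xs ! j)) + (\<Sum>i<m. \<Sum>j<m. g (xs ! i) (xs ! j))" for v xs
    by (simp add: sum.lessThan_Suc_shift sum.distrib diag sym[of _ v] del: sum.lessThan_Suc)
  have "(\<Sum>xs\<in>nlists n (Suc m). \<Sum>i<Suc m. \<Sum>j<Suc m. g (xs ! i) (xs ! j)) =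
     2 * (\<Sum>v<n. \<Sum>xs\<in>nlists n m. \<Sum>j<m. g v (xs ! j)) + real n * S"
    unfolding sum_nlists_Suc step by (simp add: sum.distrib sum_distrib_left S_def)
  then have "real n ^ 2 * (\<Sum>xs\<in>nlists n (Suc m). \<Sum>i<Suc m. \<Sum>j<Suc m. g (xs ! i) (xs ! j)) =
     2 * real n * (\<Sum>v<n. real n * (\<Sum>xs\<in>nlists n m. \<Sum>j<m. g v (xs ! j))) + real n * (real n ^ 2 * S)"
    by (simp add: algebra_simps power2_eq_square sum_distrib_left)
  also have "(\<Sum>v<n. real n * (\<Sum>xs\<in>nlists n m. \<Sum>j<m. g v (xs ! j))) = real m * real n ^ m * G"
    unfolding sum_nlists_marginal by (simp add: G_def sum_distrib_left)
  also have "real n ^ 2 * S = real m * (real m - 1) * real n ^ m * G"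
    using Suc.IH by (simp add: S_def G_def)
  finally show ?case by (simp add: G_def algebra_simps)
qed simp

text \<open>The clique is a set of positions: a sample is treated as a graph on
  \<open>{..<m}\<close>, in which two copies of the same vertex are non-adjacent when
  \<open>adj\<close> is irreflexive.\<close>

definition clique_lists :: "(nat \<Rightarrow> nat \<Rightarrow> bool) \<Rightarrow> nat \<Rightarrow> nat \<Rightarrow> nat \<Rightarrow> nat list set" where
  "clique_lists adj k n m = {xs\<in>nlists n m. \<exists>I\<subseteq>{..<m}. card I = Suc k \<and> pairwise (\<lambda>i j. adj (xs ! i) (xs ! j)) I}"

text \<open>Averages the form over all samples. Clique-free samples obey the bound for clique-free
  graphs on \<open>m\<close> vertices. In the others, at most \<open>\<delta> * n ^ m\<close> in
  number, each of the \<open>m^2\<close> terms is at most \<open>4 * B / n\<close> by the cap on the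
  weights. The factors \<open>m - 1\<close> and \<open>m\<close> are the densities of pairs and of
  single positions.\<close>

lemma sampled_q_form_le:
  fixes x :: "nat \<Rightarrow> real"
  assumes asym: "\<And>u v. adj u v = adj v u" and irr: "\<And>u. \<not> adj u u" and k: "2 \<le> k"
    and m: "1 \<le> m" and n: "1 \<le> n" and B: "\<And>v. v < n \<Longrightarrow> (x v)^2 \<le> B / real n"
    and bad: "real (card (clique_lists adj k n m)) \<le> \<delta> * real n ^ m"
  shows "(real m - 1) * (\<Sum>u<n. \<Sum>v<n. of_bool (adj u v) * (x u + x v)^2) \<le>
    real m * real n * (4 * (1 - 1 / real k) * (\<Sum>v<n. (x v)^2) + 4 * B * \<delta>)"
proof -
  define \<kappa> where "\<kappa> = 4 * (1 - 1 / real k)"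
  have \<kappa>0: "0 \<le> \<kappa>" using k by (simp add: \<kappa>_def field_simps)
  define Q where "Q = (\<Sum>u<n. \<Sum>v<n. of_bool (adj u v) * (x u + x v)^2)"
  define s where "s = (\<Sum>v<n. (x v)^2)"
  define b where "b = B / real n"
  have b0: "0 \<le> b" using B[of 0] n unfolding b_def by (smt (verit) zero_le_power2 less_le_trans zero_less_one)
  let ?g = "\<lambda>u v. of_bool (adj u v) * (x u + x v)^2"
  have each: "(\<Sum>i<m. \<Sum>j<m. ?g (xs ! i) (xs ! j)) \<le>
      \<kappa> * real m * (\<Sum>i<m. (x (xs ! i))^2) + of_bool (xs \<in> clique_lists adj k n m) * (real m ^ 2 * (4 * b))"
    if xs: "xs \<in> nlists n m" for xs
  proof (cases "xs \<in> clique_lists adj k n m")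
    case True
    have "?g (xs ! i) (xs ! j) \<le> 4 * b" if "i < m" "j < m" for i j
    proof -
      have "xs ! i < n" "xs ! j < n" using xs that by (auto simp: nlists_def subset_iff)
      then have "(x (xs ! i))^2 \<le> b" "(x (xs ! j))^2 \<le> b" using B by (auto simp: b_def)
      moreover have "(x (xs ! i) + x (xs ! j))^2 \<le> 2 * (x (xs ! i))^2 + 2 * (x (xs ! j))^2"
        using zero_le_power2[of "x (xs ! i) - x (xs ! j)"] by (simp add: power2_eq_square algebra_simps)
      ultimately show ?thesis using b0 by auto
    qed
    then have "(\<Sum>i<m. \<Sum>j<m. ?g (xs ! i) (xs ! j)) \<le> (\<Sum>i<m. \<Sum>j<m. 4 * b)"
      by (intro sum_mono) auto
    also have "\<dots> = real m ^ 2 * (4 * b)" by (simp add: power2_eq_square)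
    also have "\<dots> \<le> \<kappa> * real m * (\<Sum>i<m. (x (xs ! i))^2) + real m ^ 2 * (4 * b)"
      using \<kappa>0 by (simp add: sum_nonneg)
    finally show ?thesis using True by simp
  next
    case False
    then have "\<not> (\<exists>C\<subseteq>{..<m}. card C = Suc k \<and> pairwise (\<lambda>i j. adj (xs ! i) (xs ! j)) C)"
      using xs by (auto simp: clique_lists_def)
    from clique_free_q_form_le[OF asym irr _ this k, of "\<lambda>i. x (xs ! i)"] False show ?thesis
      by (simp add: \<kappa>_def)
  qed
  have sub: "nlists n m \<inter> clique_lists adj k n m = clique_lists adj k n m"
    by (auto simp: clique_lists_def)
  have "(\<Sum>xs\<in>nlists n m. \<Sum>i<m. \<Sum>j<m. ?g (xs ! i) (xs ! j)) \<le> (\<Sum>xs\<in>nlists n m. 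
      \<kappa> * real m * (\<Sum>i<m. (x (xs ! i))^2) + of_bool (xs \<in> clique_lists adj k n m) * (real m ^ 2 * (4 * b)))"
    by (intro sum_mono each)
  also have "\<dots> = \<kappa> * real m * (\<Sum>xs\<in>nlists n m. \<Sum>i<m. (x (xs ! i))^2) + real (card (clique_lists adj k n m)) * (real m ^ 2 * (4 * b))"
    using finite_nlists[of n m] sub by (simp add: sum.distrib sum_distrib_left sum_distrib_right[symmetric])
  also have "\<dots> \<le> \<kappa> * real m * (\<Sum>xs\<in>nlists n m. \<Sum>i<m. (x (xs ! i))^2) + (\<delta> * real n ^ m) * (real m ^ 2 * (4 * b))"
    using b0 by (intro add_left_mono mult_right_mono bad) auto
  finally have "real n ^ 2 * (\<Sum>xs\<in>nlists n m. \<Sum>i<m. \<Sum>j<m. ?g (xs ! i) (xs ! j)) \<le>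
     real n ^ 2 * (\<kappa> * real m * (\<Sum>xs\<in>nlists n m. \<Sum>i<m. (x (xs ! i))^2) + (\<delta> * real n ^ m) * (real m ^ 2 * (4 * b)))"
    by (intro mult_left_mono) auto
  also have "\<dots> = \<kappa> * real m * real n * (real n * (\<Sum>xs\<in>nlists n m. \<Sum>i<m. (x (xs ! i))^2)) +
      (\<delta> * real n ^ m) * (real m ^ 2 * (4 * (b * real n) * real n))"
    by (simp add: algebra_simps power2_eq_square)
  also have "b * real n = B" using n by (simp add: b_def)
  also have "real n * (\<Sum>xs\<in>nlists n m. \<Sum>i<m. (x (xs ! i))^2) = real m * real n ^ m * s"
    unfolding s_def by (rule sum_nlists_marginal)
  also have "real n ^ 2 * (\<Sum>xs\<in>nlists n m. \<Sum>i<m. \<Sum>j<m. ?g (xs ! i) (xs ! j)) = real m * (real m - 1) * real n ^ m * Q"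
    unfolding Q_def using asym irr by (intro sum_nlists_pair_marginal) (auto simp: add.commute)
  finally have "(real m * real n ^ m) * ((real m - 1) * Q) \<le> (real m * real n ^ m) * (real m * real n * (\<kappa> * s + 4 * B * \<delta>))"
    by (simp add: algebra_simps power2_eq_square)
  then have "(real m - 1) * Q \<le> real m * real n * (\<kappa> * s + 4 * B * \<delta>)"
    using m n by (subst (asm) mult_le_cancel_left_pos) auto
  then show ?thesis unfolding Q_def s_def \<kappa>_def by simp
qed

text \<open>For an irreflexive \<open>adj\<close>, completeness between the sides forces them to be
  disjoint.\<close>

definition blowup_free :: "(nat \<Rightarrow> nat \<Rightarrow> bool) \<Rightarrow> nat \<Rightarrow> nat \<Rightarrow> nat \<Rightarrow> bool" where
  "blowup_free adj K T n \<longleftrightarrow> \<not> (\<exists>A. (\<forall>i<K. A i \<subseteq> {..<n} \<and> card (A i) = T) \<and>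
     (\<forall>i<K. \<forall>j<K. i \<noteq> j \<longrightarrow> (\<forall>a\<in>A i. \<forall>b\<in>A j. adj a b)))"

text \<open>There are at most \<open>2 ^ m\<close> position sets for a clique. If one of them
  occurred in more than \<open>\<delta> / 2 ^ m\<close> of the samples, these samples would contain
  a box, and the \<open>k + 1\<close> sides of the box at those positions would form a forbidden
  blow-up.\<close>

lemma few_clique_lists:
  fixes \<delta> :: real
  assumes "0 < \<delta>" "1 \<le> T"
  shows "\<exists>n0. \<forall>n\<ge>n0. \<forall>adj. blowup_free adj (Suc k) T n \<longrightarrow>
    real (card (clique_lists adj k n m)) \<le> \<delta> * real n ^ m"
proof -
  define \<delta>' where "\<delta>' = \<delta> / 2 ^ m"
  have "0 < \<delta>'" using assms by (simp add: \<delta>'_def)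
  then obtain n0 where n0: "\<And>n R. n \<ge> n0 \<Longrightarrow> R \<subseteq> nlists n m \<Longrightarrow> \<delta>' * real n ^ m \<le> real (card R) \<Longrightarrow>
    contains_box n m T R"
    using dense_relation_contains_box[of \<delta>' m T] by blast
  show ?thesis
  proof (intro exI[of _ n0] allI impI)
    fix n adj assume n: "n0 \<le> n" and free: "blowup_free adj (Suc k) T n"
    define R where "R I = {xs\<in>nlists n m. pairwise (\<lambda>i j. adj (xs ! i) (xs ! j)) I}" for I
    define \<I> where "\<I> = {I. I \<subseteq> {..<m} \<and> card I = Suc k}"
    have fin\<I>: "finite \<I>" by (auto simp: \<I>_def)
    have cI: "card \<I> \<le> 2 ^ m"
      using card_mono[of "Pow {..<m}" \<I>] by (auto simp: \<I>_def card_Pow)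
    have small: "real (card (R I)) \<le> \<delta>' * real n ^ m" if I: "I \<in> \<I>" for I
    proof (rule ccontr)
      assume "\<not> ?thesis"
      moreover have "R I \<subseteq> nlists n m" by (auto simp: R_def)
      ultimately have "contains_box n m T (R I)"
        by (intro n0[OF n]) simp_all
      then obtain A where A: "\<forall>i<m. A i \<subseteq> {..<n} \<and> card (A i) = T"
        and AR: "\<forall>xs. length xs = m \<and> (\<forall>i<m. xs ! i \<in> A i) \<longrightarrow> xs \<in> R I"
        unfolding contains_box_def by (elim exE conjE)
      have ne: "\<exists>a. a \<in> A i" if "i < m" for i
        using A that assms(2) by (metis card.empty ex_in_conv not_one_le_zero)
      have "finite I" using I by (auto simp: \<I>_def intro: finite_subset)
      then obtain f where f: "bij_betw f {0..<Suc k} I"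
        using I ex_bij_betw_nat_finite[of I] by (auto simp: \<I>_def)
      have fm: "f i < m" if "i < Suc k" for i
      proof -
        have "f i \<in> I" using f that by (auto simp: bij_betw_def)
        then show ?thesis using I by (auto simp: \<I>_def)
      qed
      have "adj a b" if ij: "i < Suc k" "j < Suc k" "i \<noteq> j" and ab: "a \<in> A (f i)" "b \<in> A (f j)" for i j a b
      proof -
        have fij: "f i \<noteq> f j" using f ij by (auto simp: bij_betw_def inj_on_def)
        \<comment> \<open>A member of the box with \<open>a\<close> and \<open>b\<close> at the two
          positions in question and arbitrary entries elsewhere; the sides are non-empty because
          \<open>T \<ge> 1\<close>.\<close>
        define xs where "xs = map (\<lambda>l. if l = f i then a else if l = f j then b else (SOME c. c \<in> A l)) [0..<m]"
        have "xs ! l \<in> A l" if "l < m" for l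
          using ab ne[OF that] someI_ex[of "\<lambda>c. c \<in> A l"] that by (auto simp: xs_def)
        then have "xs \<in> R I" using AR by (auto simp: xs_def)
        moreover have "f i \<in> I" "f j \<in> I" using f ij by (auto simp: bij_betw_def)
        ultimately have "adj (xs ! f i) (xs ! f j)" using fij by (auto simp: R_def pairwise_def)
        then show ?thesis using fm ij fij by (simp add: xs_def)
      qed
      moreover have "\<forall>i<Suc k. A (f i) \<subseteq> {..<n} \<and> card (A (f i)) = T" using A fm by blast
      ultimately have "\<not> blowup_free adj (Suc k) T n"
        unfolding blowup_free_def not_not by (intro exI[of _ "\<lambda>i. A (f i)"]) blast
      then show False using free by blast
    qed
    have "clique_lists adj k n m = (\<Union>I\<in>\<I>. R I)"
      by (auto simp: clique_lists_def \<I>_def R_def)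
    then have "real (card (clique_lists adj k n m)) \<le> real (\<Sum>I\<in>\<I>. card (R I))"
      using card_UN_le[OF fin\<I>, of R] by (simp only: of_nat_le_iff)
    also have "\<dots> = (\<Sum>I\<in>\<I>. real (card (R I)))" by simp
    also have "\<dots> \<le> real (card \<I>) * (\<delta>' * real n ^ m)"
      using sum_bounded_above[of \<I> "\<lambda>I. real (card (R I))"] small by simp
    also have "\<dots> \<le> 2 ^ m * (\<delta>' * real n ^ m)"
    proof (rule mult_right_mono)
      show "real (card \<I>) \<le> 2 ^ m" using cI by (metis of_nat_le_iff of_nat_numeral of_nat_power)
    qed (use \<open>0 < \<delta>'\<close> in auto)
    finally show "real (card (clique_lists adj k n m)) \<le> \<delta> * real n ^ m"
      by (simp add: \<delta>'_def)
  qed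
qed

text \<open>Sampling vertices uniformly misses weight concentrated on few vertices (as in a star). That part is
  split off: it contributes at most \<open>2n\<close> times its squared norm, which is affordable because
  \<open>4(1 - 1/k) \<ge> 2\<close>.\<close>

lemma q_form_truncate:
  fixes x :: "nat \<Rightarrow> real" and \<tau> :: real
  assumes x0: "\<And>v. 0 \<le> x v" and x1: "(\<Sum>v<n. (x v)^2) = 1" and \<tau>: "0 < \<tau>"
  defines "x' \<equiv> \<lambda>v. if x v \<le> \<tau> then x v else 0"
  shows "(\<Sum>u<n. \<Sum>v<n. of_bool (adj u v) * (x u + x v)^2) \<le>
    (\<Sum>u<n. \<Sum>v<n. of_bool (adj u v) * (x' u + x' v)^2) + 2 * real n * (1 - (\<Sum>v<n. (x' v)^2)) + 4 * sqrt (real n) / \<tau>"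
proof -
  define x'' where "x'' v = (if x v \<le> \<tau> then 0 else x v)" for v
  have x'0: "0 \<le> x' v" "0 \<le> x'' v" for v using x0 by (auto simp: x'_def x''_def)
  have sq: "(x v)^2 = (x' v)^2 + (x'' v)^2" for v by (auto simp: x'_def x''_def)
  have xe: "x v = x' v + x'' v" for v by (auto simp: x'_def x''_def)
  have "of_bool (adj u v) * (x u + x v)^2 \<le> of_bool (adj u v) * (x' u + x' v)^2 + 
     ((x'' u)^2 + (x'' v)^2 + 2 * (x u * x'' v) + 2 * (x'' u * x v))" for u v
  proof -
    have "(x u + x v)^2 = (x u)^2 + (x v)^2 + 2 * (x u * x v)" by (simp add: power2_eq_square algebra_simps)
    also have "x u * x v = x' u * x' v + x' u * x'' v + x'' u * x v"
      by (simp add: xe[of u] xe[of v] algebra_simps)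
    also have "x' u * x'' v \<le> x u * x'' v" 
      using x'0 by (intro mult_right_mono) (auto simp: xe[of u])
    finally have "(x u + x v)^2 \<le> (x' u + x' v)^2 + ((x'' u)^2 + (x'' v)^2 + 2 * (x u * x'' v) + 2 * (x'' u * x v))"
      unfolding sq by (simp add: power2_eq_square algebra_simps)
    moreover have "0 \<le> (x'' u)^2 + (x'' v)^2 + 2 * (x u * x'' v) + 2 * (x'' u * x v)"
      using x0 x'0 by simp
    ultimately show ?thesis by (cases "adj u v") auto
  qed
  then have "(\<Sum>u<n. \<Sum>v<n. of_bool (adj u v) * (x u + x v)^2) \<le> (\<Sum>u<n. \<Sum>v<n. of_bool (adj u v) * (x' u + x' v)^2 + 
     ((x'' u)^2 + (x'' v)^2 + 2 * (x u * x'' v) + 2 * (x'' u * x v)))"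
    by (intro sum_mono)
  also have "\<dots> = (\<Sum>u<n. \<Sum>v<n. of_bool (adj u v) * (x' u + x' v)^2) + 2 * real n * (\<Sum>v<n. (x'' v)^2)
     + 4 * ((\<Sum>v<n. x v) * (\<Sum>v<n. x'' v))"
    by (simp add: sum.distrib sum_distrib_left[symmetric] sum_distrib_right[symmetric])
  also have "(\<Sum>v<n. (x'' v)^2) = 1 - (\<Sum>v<n. (x' v)^2)"
    using x1 by (simp add: sq sum.distrib)
  \<comment> \<open>Cauchy-Schwarz bounds the sum of all weights. Heavy weights exceed
    \<open>\<tau>\<close>, so each is at most its square divided by \<open>\<tau>\<close>.\<close>
  also have "(\<Sum>v<n. x v) * (\<Sum>v<n. x'' v) \<le> sqrt (real n) * (1 / \<tau>)"
  proof (intro mult_mono)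
    have "(\<Sum>v<n. x v)^2 \<le> real n"
      using Cauchy_Schwarz_ineq_sum[of "\<lambda>_. 1" x "{..<n}"] x1 by simp
    then show "(\<Sum>v<n. x v) \<le> sqrt (real n)" by (simp add: real_le_rsqrt)
    have "x'' v * \<tau> \<le> (x v)^2" for v
      using x0[of v] \<tau> by (auto simp: x''_def power2_eq_square intro: mult_left_mono)
    then have "(\<Sum>v<n. x'' v * \<tau>) \<le> (\<Sum>v<n. (x v)^2)" by (intro sum_mono)
    then show "(\<Sum>v<n. x'' v) \<le> 1 / \<tau>" using \<tau> x1 by (simp add: sum_distrib_right[symmetric] pos_le_divide_eq)
  qed (use x0 x'0 \<tau> in \<open>auto intro: sum_nonneg\<close>)
  finally show ?thesis by simp
qed

theorem blowup_free_q_form_le: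
  fixes \<epsilon> :: real
  assumes k: "2 \<le> k" and \<epsilon>: "0 < \<epsilon>" and T: "1 \<le> T"
  shows "\<exists>n0. \<forall>n\<ge>n0. \<forall>adj x. (\<forall>u v. adj u v = adj v u) \<and> (\<forall>u. \<not> adj u u) \<and> blowup_free adj (Suc k) T n \<and>
     (\<forall>v. 0 \<le> x v) \<and> (\<Sum>v<n. (x v)^2) = 1 \<longrightarrow>
    (\<Sum>u<n. \<Sum>v<n. of_bool (adj u v) * (x u + x v)^2) \<le> (4 * (1 - 1 / real k) + \<epsilon>) * real n"
proof -
  \<comment> \<open>The budget: with the threshold \<open>\<tau> = sqrt (B / n)\<close>, truncation
    costs \<open>4 * n / sqrt B\<close>, that is \<open>\<epsilon> / 3 * n\<close>. The bad samples
    cost \<open>4 * B * \<delta> = \<epsilon> / 6\<close>. With \<open>m = M + 1\<close> the ratio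
    \<open>m / (m - 1)\<close> is \<open>1 + 1 / M\<close>, which costs at most
    \<open>4 / M \<le> \<epsilon> / 3\<close> on the main term and another
    \<open>\<epsilon> / 6\<close> on the bad samples.\<close>
  define B where "B = (12 / \<epsilon>)^2"
  define \<delta> where "\<delta> = \<epsilon> / (24 * B)"
  have B0: "0 < B" and \<delta>0: "0 < \<delta>" using \<epsilon> by (auto simp: B_def \<delta>_def)
  have sB: "4 / sqrt B = \<epsilon> / 3" using \<epsilon> by (simp add: B_def)
  obtain M where M: "12 / \<epsilon> < real M" using reals_Archimedean2 by blast
  then have M0: "0 < M" using \<epsilon> by (metis divide_pos_pos gr0I of_nat_0 order_less_asym zero_less_numeral)
  define m where "m = Suc M"
  obtain n1 where n1: "\<And>n adj. n \<ge> n1 \<Longrightarrow> blowup_free adj (Suc k) T n \<Longrightarrow>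
    real (card (clique_lists adj k n m)) \<le> \<delta> * real n ^ m"
    using few_clique_lists[OF \<delta>0 T, of k m] by blast
  show ?thesis
  proof (intro exI[of _ "max n1 1"] allI impI)
    fix n :: nat and adj :: "nat \<Rightarrow> nat \<Rightarrow> bool" and x :: "nat \<Rightarrow> real"
    assume n: "max n1 1 \<le> n" and "(\<forall>u v. adj u v = adj v u) \<and> (\<forall>u. \<not> adj u u) \<and> blowup_free adj (Suc k) T n \<and>
     (\<forall>v. 0 \<le> x v) \<and> (\<Sum>v<n. (x v)^2) = 1"
    then have adj: "\<And>u v. adj u v = adj v u" "\<And>u. \<not> adj u u" "blowup_free adj (Suc k) T n"
      and x: "\<And>v. 0 \<le> x v" "(\<Sum>v<n. (x v)^2) = 1" by auto
    define \<tau> where "\<tau> = sqrt (B / real n)"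
    have n0: "0 < real n" using n by simp
    have \<tau>0: "0 < \<tau>" using n0 B0 by (simp add: \<tau>_def)
    define x' where "x' v = (if x v \<le> \<tau> then x v else 0)" for v
    define Q where "Q = (\<Sum>u<n. \<Sum>v<n. of_bool (adj u v) * (x' u + x' v)^2)"
    define s where "s = (\<Sum>v<n. (x' v)^2)"
    have s: "0 \<le> s" "s \<le> 1"
    proof -
      show "0 \<le> s" by (simp add: s_def sum_nonneg)
      have "s \<le> (\<Sum>v<n. (x v)^2)" unfolding s_def by (intro sum_mono) (auto simp: x'_def)
      then show "s \<le> 1" using x by simp
    qed
    define \<kappa> where "\<kappa> = 4 * (1 - 1 / real k)"
    have \<kappa>: "2 \<le> \<kappa>" "\<kappa> \<le> 4" using k by (auto simp: \<kappa>_def field_simps)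
    have "(x' v)^2 \<le> B / real n" for v
    proof -
      have "(x' v)^2 \<le> \<tau>^2" using x(1)[of v] \<tau>0 by (intro power_mono) (auto simp: x'_def)
      then show ?thesis using B0 by (simp add: \<tau>_def)
    qed
    then have "(real m - 1) * Q \<le> real m * real n * (\<kappa> * s + 4 * B * \<delta>)"
      unfolding Q_def s_def \<kappa>_def
      using n by (intro sampled_q_form_le adj k n1) (auto simp: m_def)
    also have "4 * B * \<delta> = \<epsilon> / 6" using B0 by (simp add: \<delta>_def)
    finally have "real M * Q \<le> (real M + 1) * (real n * (\<kappa> * s + \<epsilon> / 6))"
      by (simp add: m_def mult.assoc add.commute)
    then have "Q \<le> (1 + 1 / real M) * (real n * (\<kappa> * s + \<epsilon> / 6))"
      using M0 by (simp add: field_simps)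
    also have "\<dots> = real n * (\<kappa> * s + \<epsilon> / 6 + \<kappa> * s / real M + \<epsilon> / 6 / real M)"
      by (simp add: algebra_simps)
    also have "\<dots> \<le> real n * (\<kappa> * s + \<epsilon> / 6 + \<epsilon> / 3 + \<epsilon> / 6)"
    proof (intro mult_left_mono add_mono order_refl)
      have "\<kappa> * s \<le> 4 * 1" using s \<kappa> by (intro mult_mono) auto
      then have "\<kappa> * s / real M \<le> 4 / real M" using M0 by (intro divide_right_mono) auto
      also have "\<dots> \<le> \<epsilon> / 3" using M M0 \<epsilon> by (simp add: field_simps)
      finally show "\<kappa> * s / real M \<le> \<epsilon> / 3" .
      show "\<epsilon> / 6 / real M \<le> \<epsilon> / 6" using M0 \<epsilon> by (simp add: field_simps)
    qed (use \<kappa> in auto)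
    finally have Q: "Q \<le> real n * (\<kappa> * s + 2 * \<epsilon> / 3)" by (simp add: field_simps)
    have "sqrt (real n) / \<tau> = real n / sqrt B"
      using n0 B0 by (simp add: \<tau>_def real_sqrt_divide)
    then have "4 * (sqrt (real n) / \<tau>) = real n * (4 / sqrt B)" by simp
    then have "4 * sqrt (real n) / \<tau> = real n * (\<epsilon> / 3)" unfolding sB by simp
    then have "(\<Sum>u<n. \<Sum>v<n. of_bool (adj u v) * (x u + x v)^2) \<le> Q + 2 * real n * (1 - s) + real n * (\<epsilon> / 3)"
      using q_form_truncate[OF x \<tau>0, of adj] unfolding Q_def s_def x'_def by simp
    also have "\<dots> \<le> real n * (\<kappa> * s + 2 * \<epsilon> / 3) + \<kappa> * real n * (1 - s) + real n * (\<epsilon> / 3)"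
      using Q \<kappa>(1) s by (intro add_mono mult_right_mono order_refl) auto
    also have "\<dots> = (\<kappa> + \<epsilon>) * real n" by (simp add: algebra_simps)
    finally show "(\<Sum>u<n. \<Sum>v<n. of_bool (adj u v) * (x u + x v)^2) \<le> (4 * (1 - 1 / real k) + \<epsilon>) * real n"
      by (simp add: \<kappa>_def)
  qed
qed

section \<open>From linear hypergraphs to their shadows\<close>

text \<open>AM-GM, from \<open>ln t \<le> t - 1\<close> at \<open>t = a i / G\<close>, where the
  logarithms add up to 0. The geometric mean is a parameter because the application knows it as a
  product, so that no root has to be taken.\<close>

lemma prod_root_le_mean:
  fixes a :: "'i \<Rightarrow> real"
  assumes "finite I" "\<And>i. i \<in> I \<Longrightarrow> 0 \<le> a i" "0 \<le> G" "(\<Prod>i\<in>I. a i) = G ^ card I"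
  shows "real (card I) * G \<le> (\<Sum>i\<in>I. a i)"
proof (cases "G = 0")
  case True
  then show ?thesis using assms(2) by (simp add: sum_nonneg)
next
  case False
  then have G: "0 < G" using assms(3) by simp
  then have "(\<Prod>i\<in>I. a i) \<noteq> 0" using assms(4) by simp
  then have pos: "0 < a i" if "i \<in> I" for i
    using assms(1) assms(2)[OF that] that by (simp add: less_le prod_zero_iff)
  have "(\<Sum>i\<in>I. ln (a i / G)) = ln (\<Prod>i\<in>I. a i / G)"
    using assms(1) pos G by (subst ln_prod) (force dest: pos)+
  also have "(\<Prod>i\<in>I. a i / G) = 1"
    using assms(4) G by (simp add: prod_dividef)
  finally have "0 = (\<Sum>i\<in>I. ln (a i / G))" by simp
  also have "\<dots> \<le> (\<Sum>i\<in>I. a i / G - 1)"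
    using pos G by (intro sum_mono ln_le_minus_one) auto
  also have "\<dots> = (\<Sum>i\<in>I. a i) / G - real (card I)"
    by (simp add: sum_subtractf sum_divide_distrib)
  finally show ?thesis using G by (simp add: field_simps)
qed

lemma sum_off_diagonal_eq:
  fixes f :: "'i \<Rightarrow> real"
  assumes "finite e" "card e = r"
  shows "(\<Sum>u\<in>e. \<Sum>v\<in>e - {u}. f u) = (real r - 1) * (\<Sum>u\<in>e. f u)"
    and "(\<Sum>u\<in>e. \<Sum>v\<in>e - {u}. f v) = (real r - 1) * (\<Sum>u\<in>e. f u)"
proof -
  have c: "real (card (e - {u})) = real r - 1" if "u \<in> e" for u
  proof -
    have "card e > 0" using assms that by (auto simp: card_gt_0_iff)
    then show ?thesis using assms that by (simp add: of_nat_diff)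
  qed
  show "(\<Sum>u\<in>e. \<Sum>v\<in>e - {u}. f u) = (real r - 1) * (\<Sum>u\<in>e. f u)"
    using c by (simp add: sum_distrib_left)
  have "(\<Sum>u\<in>e. \<Sum>v\<in>e - {u}. f v) = (\<Sum>u\<in>e. (\<Sum>v\<in>e. f v) - f u)"
    using assms(1) by (intro sum.cong refl) (simp add: sum_diff1)
  also have "\<dots> = (real r - 1) * (\<Sum>u\<in>e. f u)"
    using assms by (simp add: sum_subtractf left_diff_distrib)
  finally show "(\<Sum>u\<in>e. \<Sum>v\<in>e - {u}. f v) = (real r - 1) * (\<Sum>u\<in>e. f u)" .
qed

text \<open>AM-GM is applied to the products \<open>y u * y v\<close> over the r(r-1) ordered pairs
  of distinct vertices of \<open>e\<close>. Each vertex occurs in 2(r-1) of these pairs and (y v)^2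
  = |x v|^r, so the product of all of them is the r(r-1)-th power of the product of the |x v|. On
  the right each square (y v)^2 also occurs 2(r-1) times, whence the constant.\<close>

lemma edge_contribution_le:
  fixes x y :: "'i \<Rightarrow> real"
  assumes "finite e" "card e = r" "2 \<le> r" and y: "\<And>v. 0 \<le> y v" "\<And>v. (y v)^2 = \<bar>x v\<bar> ^ r"
  shows "(\<Sum>v\<in>e. x v ^ r) + real r * (\<Prod>v\<in>e. x v)
    \<le> 1 / (2 * (real r - 1)) * (\<Sum>u\<in>e. \<Sum>v\<in>e - {u}. (y u + y v)^2)"
proof -
  define G where "G = (\<Prod>v\<in>e. \<bar>x v\<bar>)"
  define I where "I = (SIGMA u:e. e - {u})"
  have finI: "finite I" using assms(1) by (auto simp: I_def)
  have c: "card (e - {u}) = r - 1" if "u \<in> e" for u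
    using assms that by simp
  have cI: "card I = r * (r - 1)"
    unfolding I_def using assms(1,2) c by (simp add: card_SigmaI)
  have r1: "real (r - 1) = real r - 1" using assms(3) by simp
  have "(\<Prod>p\<in>I. y (fst p) * y (snd p)) = (\<Prod>u\<in>e. \<Prod>v\<in>e - {u}. y u * y v)"
    unfolding I_def using assms(1) by (subst prod.Sigma) (auto simp: case_prod_beta)
  also have "\<dots> = (\<Prod>u\<in>e. \<Prod>v\<in>e - {u}. y u) * (\<Prod>u\<in>e. \<Prod>v\<in>e - {u}. y v)"
    by (simp add: prod.distrib)
  also have "(\<Prod>u\<in>e. \<Prod>v\<in>e - {u}. y v) = (\<Prod>u\<in>e. \<Prod>v\<in>e - {u}. y u)"
  proof -
    have "(\<Prod>u\<in>e. \<Prod>v\<in>e - {u}. y v) = (\<Prod>u\<in>e. \<Prod>v\<in>{v\<in>e. u \<noteq> v}. y v)"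
      by (intro prod.cong refl) auto
    also have "\<dots> = (\<Prod>v\<in>e. \<Prod>u\<in>{u\<in>e. u \<noteq> v}. y v)"
      using assms(1) by (rule prod.swap_restrict) (rule assms(1))
    also have "\<dots> = (\<Prod>u\<in>e. \<Prod>v\<in>e - {u}. y u)"
      by (intro prod.cong refl) auto
    finally show ?thesis .
  qed
  also have "(\<Prod>u\<in>e. \<Prod>v\<in>e - {u}. y u) = (\<Prod>u\<in>e. y u ^ (r - 1))"
    using c by (intro prod.cong refl) simp
  also have "(\<Prod>u\<in>e. y u ^ (r - 1)) * (\<Prod>u\<in>e. y u ^ (r - 1)) = (\<Prod>u\<in>e. \<bar>x u\<bar> ^ (r * (r - 1)))"
  proof -
    have "y u ^ (r - 1) * y u ^ (r - 1) = \<bar>x u\<bar> ^ (r * (r - 1))" for u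
      by (metis power_mult_distrib power2_eq_square y(2) power_mult)
    then show ?thesis by (simp only: prod.distrib[symmetric])
  qed
  also have "\<dots> = G ^ card I" by (simp add: G_def cI prod_power_distrib)
  finally have "real (card I) * G \<le> (\<Sum>p\<in>I. y (fst p) * y (snd p))"
    using finI y by (intro prod_root_le_mean) (auto simp: G_def prod_nonneg)
  also have "\<dots> = (\<Sum>u\<in>e. \<Sum>v\<in>e - {u}. y u * y v)"
    unfolding I_def using assms(1) by (subst sum.Sigma) (auto simp: case_prod_beta)
  finally have amgm: "(real r - 1) * (real r * G) \<le> (\<Sum>u\<in>e. \<Sum>v\<in>e - {u}. y u * y v)"
    unfolding cI of_nat_mult r1 by (simp add: mult_ac)
  have "(\<Prod>v\<in>e. x v) \<le> G" unfolding G_def abs_prod[symmetric] by simp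
  then have "real r * (\<Prod>v\<in>e. x v) \<le> real r * G" by (simp add: mult_left_mono)
  moreover have "(\<Sum>v\<in>e. x v ^ r) \<le> (\<Sum>v\<in>e. (y v)^2)"
    unfolding y by (intro sum_mono) (metis abs_ge_self power_abs)
  ultimately have "2 * (real r - 1) * ((\<Sum>v\<in>e. x v ^ r) + real r * (\<Prod>v\<in>e. x v))
      \<le> 2 * (real r - 1) * ((\<Sum>v\<in>e. (y v)^2) + real r * G)"
    using assms(3) by (intro mult_left_mono add_mono) auto
  also have "\<dots> \<le> (\<Sum>u\<in>e. \<Sum>v\<in>e - {u}. (y u)^2) + (\<Sum>u\<in>e. \<Sum>v\<in>e - {u}. (y v)^2)
     + 2 * (\<Sum>u\<in>e. \<Sum>v\<in>e - {u}. y u * y v)"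
    unfolding sum_off_diagonal_eq(1)[OF assms(1,2)] sum_off_diagonal_eq(2)[OF assms(1,2)]
    using amgm by (simp add: algebra_simps)
  also have "\<dots> = (\<Sum>u\<in>e. \<Sum>v\<in>e - {u}. (y u + y v)^2)"
    unfolding sum.distrib[symmetric] sum_distrib_left
    by (intro sum.cong refl) (simp add: power2_eq_square algebra_simps)
  finally show ?thesis using assms(3) by (simp add: field_simps)
qed

definition shadow_adj :: "nat set set \<Rightarrow> nat \<Rightarrow> nat \<Rightarrow> bool" where
  "shadow_adj H u v \<longleftrightarrow> u \<noteq> v \<and> (\<exists>h\<in>H. u \<in> h \<and> v \<in> h)"

lemma uniform_hypergraph_finite:
  assumes "uniform_hypergraph n r H"
  shows "finite H" "\<And>e. e \<in> H \<Longrightarrow> finite e" "\<And>e. e \<in> H \<Longrightarrow> card e = r" "\<And>e. e \<in> H \<Longrightarrow> e \<subseteq> {..<n}"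
proof -
  show H: "\<And>e. e \<in> H \<Longrightarrow> e \<subseteq> {..<n}" "\<And>e. e \<in> H \<Longrightarrow> card e = r"
    using assms by (auto simp: uniform_hypergraph_def)
  then show "\<And>e. e \<in> H \<Longrightarrow> finite e" by (meson finite_lessThan finite_subset)
  show "finite H" using H(1) by (meson PowI finite_Pow_iff finite_lessThan finite_subset subsetI)
qed

lemma sum_hdeg_mult:
  fixes f :: "nat \<Rightarrow> real"
  assumes "uniform_hypergraph n r H"
  shows "(\<Sum>v<n. real (hdeg H v) * f v) = (\<Sum>e\<in>H. \<Sum>v\<in>e. f v)"
proof -
  note H = uniform_hypergraph_finite[OF assms]
  have "(\<Sum>v<n. real (hdeg H v) * f v) = (\<Sum>v<n. \<Sum>e\<in>{e\<in>H. v \<in> e}. f v)"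
    by (simp add: hdeg_def)
  also have "\<dots> = (\<Sum>e\<in>H. \<Sum>v\<in>{v\<in>{..<n}. v \<in> e}. f v)"
    using H(1) by (intro sum.swap_restrict) auto
  also have "\<dots> = (\<Sum>e\<in>H. \<Sum>v\<in>e. f v)"
    using H(4) by (intro sum.cong) (auto simp: subset_iff)
  finally show ?thesis .
qed

text \<open>By linearity the ordered pairs inside different edges are different, so adding up the
  bounds for single edges counts every adjacent ordered pair of the shadow exactly once.\<close>

lemma q_form_le_shadow:
  fixes x y :: "nat \<Rightarrow> real"
  assumes H: "uniform_hypergraph n r H" "linear_hypergraph H" and r: "2 \<le> r"
    and y: "\<And>v. 0 \<le> y v" "\<And>v. (y v)^2 = \<bar>x v\<bar> ^ r"
  shows "q_form n r H x \<le> 1 / (2 * (real r - 1)) * (\<Sum>u<n. \<Sum>v<n. of_bool (shadow_adj H u v) * (y u + y v)^2)"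
proof -
  note fin = uniform_hypergraph_finite[OF H(1)]
  let ?P = "\<lambda>e. SIGMA u:e. e - {u}"
  have disj: "?P e \<inter> ?P e' = {}" if "e \<in> H" "e' \<in> H" "e \<noteq> e'" for e e'
  proof (rule ccontr)
    assume "?P e \<inter> ?P e' \<noteq> {}"
    then obtain u v where uv: "u \<noteq> v" "{u, v} \<subseteq> e \<inter> e'" by auto
    then have "card {u, v} \<le> card (e \<inter> e')" using fin(2)[OF that(1)] by (intro card_mono) auto
    moreover have "card (e \<inter> e') \<le> 1" using H(2) that by (auto simp: linear_hypergraph_def)
    ultimately show False using uv by simp
  qed
  have "q_form n r H x = (\<Sum>e\<in>H. (\<Sum>v\<in>e. x v ^ r) + real r * (\<Prod>v\<in>e. x v))"
    unfolding q_form_def sum_hdeg_mult[OF H(1)] by (simp add: sum.distrib sum_distrib_left)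
  also have "\<dots> \<le> (\<Sum>e\<in>H. 1 / (2 * (real r - 1)) * (\<Sum>u\<in>e. \<Sum>v\<in>e - {u}. (y u + y v)^2))"
    by (intro sum_mono edge_contribution_le fin r y)
  also have "\<dots> = 1 / (2 * (real r - 1)) * (\<Sum>e\<in>H. \<Sum>p\<in>?P e. (y (fst p) + y (snd p))^2)"
    unfolding sum_distrib_left[symmetric]
  proof (intro arg_cong[where f = "\<lambda>t. _ * t"] sum.cong refl)
    fix e assume "e \<in> H"
    then show "(\<Sum>u\<in>e. \<Sum>v\<in>e - {u}. (y u + y v)^2) = (\<Sum>p\<in>?P e. (y (fst p) + y (snd p))^2)"
      using fin(2) by (subst sum.Sigma) (auto simp: case_prod_beta)
  qed
  also have "(\<Sum>e\<in>H. \<Sum>p\<in>?P e. (y (fst p) + y (snd p))^2) = (\<Sum>p\<in>(\<Union>e\<in>H. ?P e). (y (fst p) + y (snd p))^2)"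
    using fin disj by (intro sum.UNION_disjoint[symmetric]) auto
  also have "(\<Union>e\<in>H. ?P e) = {p\<in>{..<n} \<times> {..<n}. shadow_adj H (fst p) (snd p)}"
    using fin(4) by (auto simp: shadow_adj_def subset_iff)
  also have "(\<Sum>p\<in>\<dots>. (y (fst p) + y (snd p))^2) =
      (\<Sum>p\<in>{..<n} \<times> {..<n}. of_bool (shadow_adj H (fst p) (snd p)) * (y (fst p) + y (snd p))^2)"
    by (simp add: sum.inter_filter of_bool_def if_distrib if_distribR cong: if_cong)
  also have "\<dots> = (\<Sum>u<n. \<Sum>v<n. of_bool (shadow_adj H u v) * (y u + y v)^2)"
    by (simp only: sum.cartesian_product case_prod_unfold)
  finally show ?thesis .
qed

text \<open>The substitution turns a unit vector of the r-norm into one of the 2-norm. The bound is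
  \<open>2 * c\<close> because the double sum meets each edge of the shadow twice.\<close>

lemma q_form_le_of_shadow_bound:
  assumes H: "uniform_hypergraph n r H" "linear_hypergraph H" and r: "2 \<le> r"
    and bound: "\<And>y. (\<And>v. 0 \<le> y v) \<Longrightarrow> (\<Sum>v<n. (y v)^2) = 1 \<Longrightarrow>
       (\<Sum>u<n. \<Sum>v<n. of_bool (shadow_adj H u v) * (y u + y v)^2) \<le> 2 * c"
    and x: "(\<Sum>v<n. \<bar>x v\<bar> ^ r) = 1"
  shows "q_form n r H x \<le> c / (real r - 1)"
proof -
  define y where "y v = sqrt (\<bar>x v\<bar> ^ r)" for v
  have y: "0 \<le> y v" "(y v)^2 = \<bar>x v\<bar> ^ r" for v by (auto simp: y_def)
  have "q_form n r H x \<le> 1 / (2 * (real r - 1)) * (\<Sum>u<n. \<Sum>v<n. of_bool (shadow_adj H u v) * (y u + y v)^2)"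
    by (rule q_form_le_shadow[OF H r y])
  also have "\<dots> \<le> 1 / (2 * (real r - 1)) * (2 * c)"
    using r x y by (intro mult_left_mono bound) auto
  also have "\<dots> = c / (real r - 1)" using r by (simp add: field_simps)
  finally show ?thesis .
qed

text \<open>A crude bound, uniform in \<open>H\<close>. It makes the sets inside
  \<open>signless_q\<close> and \<open>ex_lin_q\<close> bounded above, so that their
  \<open>Sup\<close> is a genuine least upper bound.\<close>

lemma q_form_le_linear:
  assumes H: "uniform_hypergraph n r H" "linear_hypergraph H" and r: "2 \<le> r" and x: "(\<Sum>v<n. \<bar>x v\<bar> ^ r) = 1"
  shows "q_form n r H x \<le> 2 * real n / (real r - 1)"
proof (rule q_form_le_of_shadow_bound[OF H r _ x])
  fix y :: "nat \<Rightarrow> real" assume y: "\<And>v. 0 \<le> y v" "(\<Sum>v<n. (y v)^2) = 1"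
  have "of_bool (shadow_adj H u v) * (y u + y v)^2 \<le> 2 * (y u)^2 + 2 * (y v)^2" for u v
    using zero_le_power2[of "y u - y v"] by (auto simp: power2_eq_square algebra_simps)
  then have "(\<Sum>u<n. \<Sum>v<n. of_bool (shadow_adj H u v) * (y u + y v)^2) \<le> (\<Sum>u<n. \<Sum>v<n. 2 * (y u)^2 + 2 * (y v)^2)"
    by (intro sum_mono)
  also have "\<dots> = 2 * (2 * real n)"
    using y(2) by (simp add: sum.distrib sum_distrib_left[symmetric])
  finally show "(\<Sum>u<n. \<Sum>v<n. of_bool (shadow_adj H u v) * (y u + y v)^2) \<le> 2 * (2 * real n)" .
qed

section \<open>The spectral radius as a supremum over the unit sphere\<close>

lemma exists_unit_vector:
  assumes "0 < n" "0 < r"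
  shows "(\<Sum>v<n. \<bar>root r (1 / real n)\<bar> ^ r) = 1"
  using assms by simp

lemma signless_q_le:
  assumes "0 < n" "0 < r" "\<And>x. (\<Sum>v<n. \<bar>x v\<bar> ^ r) = 1 \<Longrightarrow> q_form n r H x \<le> c"
  shows "signless_q n r H \<le> c"
  unfolding signless_q_def
  using exists_unit_vector[OF assms(1,2)] assms(3)
  by (intro cSup_least) (auto intro: exI[of _ "\<lambda>_. root r (1 / real n)"])

text \<open>On the constant unit vector each edge contributes r/n through the degrees and r/n
  through its product.\<close>

lemma signless_q_ge:
  assumes H: "uniform_hypergraph n r H" "linear_hypergraph H" and r: "2 \<le> r" and n: "0 < n"
  shows "2 * real r * real (card H) / real n \<le> signless_q n r H"
proof -
  define x where "x v = root r (1 / real n)" for v :: nat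
  have x: "(\<Sum>v<n. \<bar>x v\<bar> ^ r) = 1"
    unfolding x_def using r n by (intro exists_unit_vector) auto
  have xr: "x v ^ r = 1 / real n" for v using r n by (simp add: x_def)
  note fin = uniform_hypergraph_finite[OF H(1)]
  have "q_form n r H x = (\<Sum>e\<in>H. (\<Sum>v\<in>e. 1 / real n) + real r * (1 / real n))"
    unfolding q_form_def sum_hdeg_mult[OF H(1)] xr
    unfolding sum_distrib_left sum.distrib[symmetric]
  proof (intro sum.cong refl arg_cong2[where f = "(+)"] arg_cong[where f = "\<lambda>t. real r * t"])
    fix e assume "e \<in> H"
    then have "(\<Prod>v\<in>e. x v) = root r (1 / real n) ^ r" using fin by (simp add: x_def)
    then show "(\<Prod>v\<in>e. x v) = 1 / real n" using xr[unfolded x_def] by simp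
  qed
  also have "\<dots> = (\<Sum>e\<in>H. 2 * real r / real n)"
    using fin by (intro sum.cong refl) simp
  also have "\<dots> = 2 * real r * real (card H) / real n" by simp
  finally have eq: "q_form n r H x = 2 * real r * real (card H) / real n" .
  have "bdd_above {q_form n r H x | x. (\<Sum>v<n. \<bar>x v\<bar> ^ r) = 1}"
    using q_form_le_linear[OF H r] by (intro bdd_aboveI[of _ "2 * real n / (real r - 1)"]) auto
  then have "q_form n r H x \<le> signless_q n r H"
    unfolding signless_q_def using x by (intro cSup_upper) auto
  then show ?thesis unfolding eq .
qed

section \<open>Embedding expansions\<close>

lemma linear_hypergraph_unique:
  assumes "linear_hypergraph H" "\<forall>h\<in>H. finite h" "h \<in> H" "h' \<in> H"
    and "a \<noteq> b" "a \<in> h" "b \<in> h" "a \<in> h'" "b \<in> h'"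
  shows "h = h'"
proof (rule ccontr)
  assume "h \<noteq> h'"
  then have "card (h \<inter> h') \<le> 1" using assms by (auto simp: linear_hypergraph_def)
  moreover have "card {a, b} \<le> card (h \<inter> h')" using assms by (intro card_mono) auto
  ultimately show False using assms(5) by simp
qed

text \<open>One step of closure under lines, the hyperedges of a linear hypergraph being viewed as
  lines. As two points span at most one line, a single step squares the size of \<open>X\<close> up
  to a factor \<open>r\<close>.\<close>

definition hspan :: "nat set set \<Rightarrow> nat set \<Rightarrow> nat set" where
  "hspan H X = \<Union> {h\<in>H. \<exists>a\<in>X. \<exists>b\<in>X. a \<noteq> b \<and> a \<in> h \<and> b \<in> h}"

lemma hspanI: "h \<in> H \<Longrightarrow> a \<in> X \<Longrightarrow> b \<in> X \<Longrightarrow> a \<noteq> b \<Longrightarrow> a \<in> h \<Longrightarrow> b \<in> h \<Longrightarrow> c \<in> h \<Longrightarrow> c \<in> hspan H X"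
  unfolding hspan_def by blast

lemma card_hspan_le:
  assumes lin: "linear_hypergraph H" and fin: "\<forall>h\<in>H. finite h" and "\<forall>h\<in>H. card h = r" "finite X"
  shows "finite (hspan H X)" "card (hspan H X) \<le> r * (card X)^2"
proof -
  define L where "L p = \<Union> {h\<in>H. fst p \<noteq> snd p \<and> fst p \<in> h \<and> snd p \<in> h}" for p
  have eq: "hspan H X = (\<Union>p\<in>X \<times> X. L p)"
    unfolding hspan_def L_def by fastforce
  have L: "finite (L p) \<and> card (L p) \<le> r" for p
  proof (cases "\<exists>h\<in>H. fst p \<noteq> snd p \<and> fst p \<in> h \<and> snd p \<in> h")
    case True
    then obtain h where h: "h \<in> H" "fst p \<noteq> snd p" "fst p \<in> h" "snd p \<in> h" by blast
    then have "{h\<in>H. fst p \<noteq> snd p \<and> fst p \<in> h \<and> snd p \<in> h} = {h}"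
      using linear_hypergraph_unique[OF lin fin] by blast
    then show ?thesis using h assms by (simp add: L_def)
  next
    case False
    then have "L p = {}" unfolding L_def by blast
    then show ?thesis by simp
  qed
  show "finite (hspan H X)" unfolding eq using L assms(4) by auto
  have "card (hspan H X) \<le> (\<Sum>p\<in>X \<times> X. card (L p))"
    unfolding eq using assms(4) by (intro card_UN_le) auto
  also have "\<dots> \<le> (\<Sum>p\<in>X \<times> X. r)" using L by (intro sum_mono) auto
  finally show "card (hspan H X) \<le> r * (card X)^2" by (simp add: power2_eq_square card_cartesian_product mult_ac)
qed

text \<open>If \<open>Y\<close> is the image of the vertices of a graph, this says that the hyperedges through its edges
  meet \<open>Y\<close> only in the end points and have pairwise disjoint remainders.\<close>

definition spread :: "nat set set \<Rightarrow> nat set \<Rightarrow> bool" where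
  "spread H Y \<longleftrightarrow>
     (\<forall>h\<in>H. \<forall>a\<in>h \<inter> Y. \<forall>b\<in>h \<inter> Y. \<forall>c\<in>h \<inter> Y. a = b \<or> a = c \<or> b = c) \<and>
     (\<forall>h\<in>H. \<forall>h'\<in>H. h \<noteq> h' \<longrightarrow> (\<exists>a\<in>h \<inter> Y. \<exists>b\<in>h \<inter> Y. a \<noteq> b) \<longrightarrow>
        (\<exists>a\<in>h' \<inter> Y. \<exists>b\<in>h' \<inter> Y. a \<noteq> b) \<longrightarrow> h \<inter> h' \<subseteq> Y)"

lemma spreadD1:
  assumes "spread H Y" "h \<in> H" "a \<in> h" "b \<in> h" "c \<in> h" "a \<in> Y" "b \<in> Y" "c \<in> Y"
  shows "a = b \<or> a = c \<or> b = c"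
  using assms unfolding spread_def by (meson IntI)

lemma spreadD2:
  assumes "spread H Y" "h \<in> H" "h' \<in> H" "h \<noteq> h'" "a \<in> h" "b \<in> h" "a \<noteq> b" "a \<in> Y" "b \<in> Y"
    "a' \<in> h'" "b' \<in> h'" "a' \<noteq> b'" "a' \<in> Y" "b' \<in> Y" "z \<in> h" "z \<in> h'"
  shows "z \<in> Y"
proof -
  have "h \<inter> h' \<subseteq> Y" using assms unfolding spread_def by (meson IntI)
  then show ?thesis using assms by blast
qed

text \<open>Avoiding \<open>hspan H Z\<close> means that a hyperedge through \<open>w\<close> has at
  most one point in \<open>Z\<close>; in particular it has at most one in \<open>Y\<close>. The
  second round of closure handles an old hyperedge, spanned by two points of \<open>Y\<close>,
  meeting a new one through \<open>w\<close> and some \<open>c\<close> in \<open>Y\<close>: the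
  common point lies in \<open>Z\<close>, so it is \<open>c\<close>. Two new hyperedges share only
  \<open>w\<close>, by linearity.\<close>

lemma spread_insert:
  assumes lin: "linear_hypergraph H" and fin: "\<forall>h\<in>H. finite h" and Y: "spread H Y"
    and Z: "Z = Y \<union> hspan H Y" and w: "w \<notin> Z \<union> hspan H Z"
  shows "spread H (insert w Y)"
proof -
  have old: "w \<notin> h" if "h \<in> H" "a \<in> h" "b \<in> h" "a \<noteq> b" "a \<in> Z" "b \<in> Z" for h a b
    using that w hspanI[of h H a Z b w] by blast
  have inZ: "z \<in> Z" if "h \<in> H" "a \<in> h" "b \<in> h" "a \<noteq> b" "a \<in> Y" "b \<in> Y" "z \<in> h" for h a b z
    using that hspanI[of h H a Y b z] Z by simp
  note Y1 = spreadD1[OF Y] and Y2 = spreadD2[OF Y]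
  have YZ: "Y \<subseteq> Z" using Z by blast
  have wY: "w \<notin> Y" using w YZ by blast
  have pair: "(\<exists>a b. a \<in> h \<and> b \<in> h \<and> a \<noteq> b \<and> a \<in> Y \<and> b \<in> Y) \<or> (w \<in> h \<and> (\<exists>a. a \<in> h \<and> a \<in> Y))"
    if "a \<in> h \<inter> insert w Y" "b \<in> h \<inter> insert w Y" "a \<noteq> b" for a b h
    using that by blast
  show ?thesis
    unfolding spread_def
  proof (intro conjI ballI impI subsetI)
    fix h a b c assume "h \<in> H" "a \<in> h \<inter> insert w Y" "b \<in> h \<inter> insert w Y" "c \<in> h \<inter> insert w Y"
    then show "a = b \<or> a = c \<or> b = c"
      using Y1[of h a b c] old[of h a b] old[of h a c] old[of h b c] YZ wY by (metis IntE insertE subsetD)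
  next
    fix h h' z
    assume hh: "h \<in> H" "h' \<in> H" "h \<noteq> h'" and z: "z \<in> h \<inter> h'"
      and p: "\<exists>a\<in>h \<inter> insert w Y. \<exists>b\<in>h \<inter> insert w Y. a \<noteq> b"
      and p': "\<exists>a\<in>h' \<inter> insert w Y. \<exists>b\<in>h' \<inter> insert w Y. a \<noteq> b"
    have mixed: "z \<in> insert w Y" if g: "g \<in> H" "g' \<in> H" "g \<noteq> g'" "z \<in> g" "z \<in> g'"
      and ab: "a \<in> g" "b \<in> g" "a \<noteq> b" "a \<in> Y" "b \<in> Y" and c: "w \<in> g'" "c \<in> g'" "c \<in> Y" for g g' a b c
    proof -
      have "z \<in> Z" using inZ[of g a b z] g ab by blast
      then have "z = c" using old[of g' z c] c g YZ by blast
      then show ?thesis using c by blast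
    qed
    have "(\<exists>a b. a \<in> h \<and> b \<in> h \<and> a \<noteq> b \<and> a \<in> Y \<and> b \<in> Y) \<or> (w \<in> h \<and> (\<exists>a. a \<in> h \<and> a \<in> Y))"
      "(\<exists>a b. a \<in> h' \<and> b \<in> h' \<and> a \<noteq> b \<and> a \<in> Y \<and> b \<in> Y) \<or> (w \<in> h' \<and> (\<exists>a. a \<in> h' \<and> a \<in> Y))"
      using pair p p' by blast+
    then consider (oo) "\<exists>a b. a \<in> h \<and> b \<in> h \<and> a \<noteq> b \<and> a \<in> Y \<and> b \<in> Y" "\<exists>a b. a \<in> h' \<and> b \<in> h' \<and> a \<noteq> b \<and> a \<in> Y \<and> b \<in> Y"
      | (on) "\<exists>a b. a \<in> h \<and> b \<in> h \<and> a \<noteq> b \<and> a \<in> Y \<and> b \<in> Y" "w \<in> h'" "\<exists>a. a \<in> h' \<and> a \<in> Y"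
      | (no) "\<exists>a b. a \<in> h' \<and> b \<in> h' \<and> a \<noteq> b \<and> a \<in> Y \<and> b \<in> Y" "w \<in> h" "\<exists>a. a \<in> h \<and> a \<in> Y"
      | (nn) "w \<in> h" "w \<in> h'"
      by argo
    then show "z \<in> insert w Y"
    proof cases
      case oo
      then obtain a b a' b' where "a \<in> h \<and> b \<in> h \<and> a \<noteq> b \<and> a \<in> Y \<and> b \<in> Y" "a' \<in> h' \<and> b' \<in> h' \<and> a' \<noteq> b' \<and> a' \<in> Y \<and> b' \<in> Y" by blast
      then show ?thesis using Y2[of h h' a b a' b' z] hh z by blast
    next
      case on
      then obtain a b c where "a \<in> h" "b \<in> h" "a \<noteq> b" "a \<in> Y" "b \<in> Y" "w \<in> h'" "c \<in> h'" "c \<in> Y" by blast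
      then show ?thesis using mixed[of h h' a b c] hh z by blast
    next
      case no
      then obtain a b c where "a \<in> h'" "b \<in> h'" "a \<noteq> b" "a \<in> Y" "b \<in> Y" "w \<in> h" "c \<in> h" "c \<in> Y" by blast
      then show ?thesis using mixed[of h' h a b c] hh z by blast
    next
      case nn
      then show ?thesis using linear_hypergraph_unique[OF lin fin hh(1,2), of z w] hh z by blast
    qed
  qed
qed

text \<open>\<open>z t\<close> bounds the size of \<open>t\<close> vertices together with their
  \<open>hspan\<close>. The next vertex has to avoid two rounds of this closure, hence at most
  \<open>z (z (card X))\<close> vertices, and a larger set \<open>B v\<close> always has one
  left.\<close>

lemma exists_spread_transversal:
  fixes B :: "'a \<Rightarrow> nat set" and z :: "nat \<Rightarrow> nat"
  assumes lin: "linear_hypergraph H" and fin: "\<forall>h\<in>H. finite h" and card: "\<forall>h\<in>H. card h = r"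
    and z: "\<And>t. z t = t + r * t^2"
  shows "finite X \<Longrightarrow> (\<And>v. v \<in> X \<Longrightarrow> finite (B v) \<and> z (z (card X)) < card (B v)) \<Longrightarrow>
    \<exists>\<phi>. inj_on \<phi> X \<and> (\<forall>v\<in>X. \<phi> v \<in> B v) \<and> spread H (\<phi> ` X)"
proof (induction X rule: finite_induct)
  case empty
  then show ?case by (auto simp: spread_def)
next
  case (insert v X)
  have mono: "z s \<le> z t" if "s \<le> t" for s t
    unfolding z using that by (intro add_mono mult_left_mono power_mono) auto
  have lt: "z (z (card X)) < card (B u)" if "u \<in> insert v X" for u
    using insert.prems[OF that] mono[OF mono, of "card X" "card (insert v X)"] card_mono[of "insert v X" X] insert.hyps
    by fastforce
  then obtain \<phi> where \<phi>: "inj_on \<phi> X" "\<forall>v\<in>X. \<phi> v \<in> B v" "spread H (\<phi> ` X)"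
    using insert by (metis insertCI)
  define Y where "Y = \<phi> ` X"
  define Z where "Z = Y \<union> hspan H Y"
  have finY: "finite Y" and cY: "card Y = card X"
    using insert.hyps \<phi>(1) by (auto simp: Y_def card_image)
  note sp = card_hspan_le[OF lin fin card]
  have finZ: "finite Z" using sp finY by (simp add: Z_def)
  have cZ: "card Z \<le> z (card X)"
    unfolding Z_def z using card_Un_le[of Y "hspan H Y"] sp(2)[OF finY] cY by (simp add: le_trans)
  have "card (Z \<union> hspan H Z) \<le> z (card Z)"
    unfolding z using card_Un_le[of Z "hspan H Z"] sp(2)[OF finZ] by simp
  also have "\<dots> \<le> z (z (card X))" using mono cZ by blast
  also have "\<dots> < card (B v)" using lt by blast
  finally have "\<not> B v \<subseteq> Z \<union> hspan H Z"
    using finZ sp(1)[OF finZ] by (meson card_mono finite_UnI leD)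
  then obtain w where w: "w \<in> B v" "w \<notin> Z \<union> hspan H Z" by blast
  have "spread H (insert w Y)"
    using spread_insert[OF lin fin] \<phi>(3) w(2) by (simp add: Y_def Z_def)
  moreover have "w \<notin> Y" using w by (simp add: Z_def)
  moreover have eqon: "(\<phi>(v := w)) ` X = Y" "\<And>u. u \<in> X \<Longrightarrow> (\<phi>(v := w)) u = \<phi> u"
    using insert.hyps by (auto simp: Y_def)
  moreover have "inj_on (\<phi>(v := w)) X" using \<phi>(1) eqon(2) by (metis inj_on_cong)
  ultimately have "inj_on (\<phi>(v := w)) (insert v X) \<and> (\<forall>u\<in>insert v X. (\<phi>(v := w)) u \<in> B u) \<and> spread H ((\<phi>(v := w)) ` insert v X)"
    using \<phi> w insert.hyps by (auto simp: inj_on_insert)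
  then show ?case by blast
qed

text \<open>Each vertex of the graph goes into the part of its colour, so the ends of an edge land
  in different parts and share a hyperedge. \<open>spread\<close> then supplies the disjointness
  that an expansion demands.\<close>

theorem contains_expansion_of_blowup:
  fixes V :: "'a set"
  assumes H: "uniform_hypergraph n r H" "linear_hypergraph H" and r: "2 \<le> r"
    and F: "simple_graph V E" "proper_colouring V E c K"
    and z: "\<And>t. z t = t + r * t^2"
    and A: "\<And>i. i < K \<Longrightarrow> finite (A i) \<and> z (z (card V)) < card (A i)"
    and adj: "\<And>i j a b. i < K \<Longrightarrow> j < K \<Longrightarrow> i \<noteq> j \<Longrightarrow> a \<in> A i \<Longrightarrow> b \<in> A j \<Longrightarrow> \<exists>h\<in>H. a \<in> h \<and> b \<in> h"
  shows "contains_expansion V E H"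
proof -
  have finH: "\<forall>h\<in>H. finite h" and cardH: "\<forall>h\<in>H. card h = r"
    using H(1) r by (auto simp: uniform_hypergraph_def intro: finite_subset)
  have finV: "finite V" and E: "\<And>e. e \<in> E \<Longrightarrow> e \<subseteq> V \<and> card e = 2"
    using F by (auto simp: simple_graph_def)
  have cK: "c v < K" if "v \<in> V" for v using F that by (auto simp: proper_colouring_def)
  have cne: "c u \<noteq> c v" if "e \<in> E" "u \<in> e" "v \<in> e" "u \<noteq> v" for e u v
    using F that by (auto simp: proper_colouring_def)
  have "\<exists>\<phi>. inj_on \<phi> V \<and> (\<forall>v\<in>V. \<phi> v \<in> A (c v)) \<and> spread H (\<phi> ` V)"
    by (rule exists_spread_transversal[OF H(2) finH cardH z finV]) (rule A[OF cK])
  then obtain \<phi> where \<phi>: "inj_on \<phi> V" "\<forall>v\<in>V. \<phi> v \<in> A (c v)" "spread H (\<phi> ` V)"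
    by blast
  have ex: "\<exists>h\<in>H. \<phi> ` e \<subseteq> h" if e: "e \<in> E" for e
  proof -
    obtain u v where uv: "e = {u, v}" "u \<noteq> v" using E[OF e] by (auto simp: card_2_iff)
    then have V: "u \<in> V" "v \<in> V" using E[OF e] by auto
    then obtain h where "h \<in> H" "\<phi> u \<in> h" "\<phi> v \<in> h"
      using adj[of "c u" "c v" "\<phi> u" "\<phi> v"] cK cne[OF e] \<phi>(2) uv by auto
    then show ?thesis using uv by auto
  qed
  define g where "g e = (SOME h. h \<in> H \<and> \<phi> ` e \<subseteq> h)" for e
  have g: "g e \<in> H \<and> \<phi> ` e \<subseteq> g e" if "e \<in> E" for e
    unfolding g_def by (rule someI_ex) (use ex[OF that] in blast)
  have pair: "\<exists>u v. u \<noteq> v \<and> e = {u, v} \<and> u \<in> V \<and> v \<in> V \<and> \<phi> u \<noteq> \<phi> v" if e: "e \<in> E" for e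
  proof -
    obtain u v where uv: "e = {u, v}" "u \<noteq> v" using E[OF e] by (auto simp: card_2_iff)
    then have V: "u \<in> V" "v \<in> V" using E[OF e] by auto
    then show ?thesis using uv \<phi>(1) by (metis inj_on_contraD)
  qed
  have outside: "(g e - \<phi> ` e) \<inter> \<phi> ` V = {}" if e: "e \<in> E" for e
  proof (rule ccontr)
    assume "(g e - \<phi> ` e) \<inter> \<phi> ` V \<noteq> {}"
    then obtain w where w: "w \<in> g e" "w \<in> \<phi> ` V" "w \<notin> \<phi> ` e" by blast
    obtain u v where uv: "e = {u, v}" "u \<in> V" "v \<in> V" "\<phi> u \<noteq> \<phi> v" using pair[OF e] by blast
    then have "\<phi> u \<in> g e \<inter> \<phi> ` V" "\<phi> v \<in> g e \<inter> \<phi> ` V" "w \<in> g e \<inter> \<phi> ` V" using g[OF e] w by auto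
    then have "\<phi> u = \<phi> v \<or> \<phi> u = w \<or> \<phi> v = w"
      using spreadD1[OF \<phi>(3), of "g e" "\<phi> u" "\<phi> v" w] g[OF e] by blast
    then show False using uv w by auto
  qed
  have inj: "e = e'" if e: "e \<in> E" "e' \<in> E" "g e = g e'" for e e'
  proof -
    \<comment> \<open>The hyperedge of \<open>e\<close> meets the image of \<open>V\<close> exactly
      in the ends of \<open>e\<close>, so \<open>g e\<close> determines \<open>e\<close>.\<close>
    have eq: "\<phi> ` e = g e \<inter> \<phi> ` V" if "e \<in> E" for e
      using g[OF that] outside[OF that] E[OF that] by blast
    have "\<phi> ` e = \<phi> ` e'" using eq[OF e(1)] eq[OF e(2)] e(3) by simp
    then show ?thesis using \<phi>(1) E[OF e(1)] E[OF e(2)] by (metis inj_on_image_eq_iff)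
  qed
  have disj: "(g e - \<phi> ` e) \<inter> (g e' - \<phi> ` e') = {}" if e: "e \<in> E" "e' \<in> E" "e \<noteq> e'" for e e'
  proof -
    have ne: "g e \<noteq> g e'" using inj e by blast
    have two: "\<exists>a b. a \<in> g e \<and> b \<in> g e \<and> a \<noteq> b \<and> a \<in> \<phi> ` V \<and> b \<in> \<phi> ` V" if "e \<in> E" for e
      using pair[OF that] g[OF that] by blast
    have "g e \<inter> g e' \<subseteq> \<phi> ` V"
    proof
      fix x assume x: "x \<in> g e \<inter> g e'"
      obtain a b where ab: "a \<in> g e" "b \<in> g e" "a \<noteq> b" "a \<in> \<phi> ` V" "b \<in> \<phi> ` V"
        using two[OF e(1)] by blast
      obtain a' b' where ab': "a' \<in> g e'" "b' \<in> g e'" "a' \<noteq> b'" "a' \<in> \<phi> ` V" "b' \<in> \<phi> ` V"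
        using two[OF e(2)] by blast
      show "x \<in> \<phi> ` V"
        using g[OF e(1)] g[OF e(2)] x by (intro spreadD2[OF \<phi>(3) _ _ ne ab ab']) auto
    qed
    then show ?thesis using outside e by blast
  qed
  show ?thesis
    unfolding contains_expansion_def
  proof (intro exI[of _ \<phi>] exI[of _ g] conjI ballI impI)
    show "inj_on \<phi> V" by (rule \<phi>(1))
    show "inj_on g E" using inj by (intro inj_onI) blast
  next
    fix e assume "e \<in> E"
    then show "g e \<in> H" "\<phi> ` e \<subseteq> g e" "(g e - \<phi> ` e) \<inter> \<phi> ` V = {}"
      using g outside by auto
  next
    fix e e' assume "e \<in> E" "e' \<in> E" "e \<noteq> e'"
    then show "(g e - \<phi> ` e) \<inter> (g e' - \<phi> ` e') = {}" by (rule disj)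
  qed
qed

section \<open>An almost perfect partite packing\<close>

lemma card_subsets_containing_pair:
  assumes "i < k" "j < k" "i \<noteq> j" "2 \<le> r"
  shows "card {S. S \<subseteq> {..<k} \<and> card S = r \<and> i \<in> S \<and> j \<in> S} = (k - 2) choose (r - 2)"
proof -
  let ?U = "{..<k} - {i, j}"
  have "bij_betw (\<lambda>A. A \<union> {i, j}) {A. A \<subseteq> ?U \<and> card A = r - 2} {S. S \<subseteq> {..<k} \<and> card S = r \<and> i \<in> S \<and> j \<in> S}"
  proof (rule bij_betw_byWitness[where f' = "\<lambda>S. S - {i, j}"])
    show "(\<lambda>A. A \<union> {i, j}) ` {A. A \<subseteq> ?U \<and> card A = r - 2} \<subseteq> {S. S \<subseteq> {..<k} \<and> card S = r \<and> i \<in> S \<and> j \<in> S}"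
    proof (intro image_subsetI CollectI conjI; (elim CollectE conjE)?)
      fix A assume A: "A \<subseteq> ?U" "card A = r - 2"
      then have "finite A" using finite_subset by blast
      moreover have "A \<inter> {i, j} = {}" using A by blast
      ultimately show "card (A \<union> {i, j}) = r"
        using A assms by (subst card_Un_disjoint) auto
      show "A \<union> {i, j} \<subseteq> {..<k}" using A(1) assms by auto
    qed simp_all
    show "(\<lambda>S. S - {i, j}) ` {S. S \<subseteq> {..<k} \<and> card S = r \<and> i \<in> S \<and> j \<in> S} \<subseteq> {A. A \<subseteq> ?U \<and> card A = r - 2}"
    proof (intro image_subsetI CollectI conjI; (elim CollectE conjE)?)
      fix S assume "S \<subseteq> {..<k}" "card S = r" "i \<in> S" "j \<in> S"
      then show "card (S - {i, j}) = r - 2"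
        using assms by (subst card_Diff_subset) auto
    qed blast
  next
    show "\<forall>A\<in>{A. A \<subseteq> ?U \<and> card A = r - 2}. A \<union> {i, j} - {i, j} = A" by blast
    show "\<forall>S\<in>{S. S \<subseteq> {..<k} \<and> card S = r \<and> i \<in> S \<and> j \<in> S}. S - {i, j} \<union> {i, j} = S" by blast
  qed
  from bij_betw_same_card[OF this]
  have "card {S. S \<subseteq> {..<k} \<and> card S = r \<and> i \<in> S \<and> j \<in> S} = card {A. A \<subseteq> ?U \<and> card A = r - 2}"
    by (rule sym)
  also have "\<dots> = card ?U choose (r - 2)" by (intro n_subsets) auto
  also have "card ?U = k - 2" using assms by (subst card_Diff_subset) auto
  finally show ?thesis .
qed

text \<open>Numbers the r-sets through \<open>i\<close> and \<open>j\<close> below their count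
  \<open>mu\<close>. In the packing \<open>mu * m + ix i j S\<close> then encodes \<open>m\<close>
  as quotient and \<open>S\<close> through the remainder, which is how these r-sets share the vertex
  pairs between parts \<open>i\<close> and \<open>j\<close>.\<close>

lemma exists_pair_index:
  assumes "2 \<le> r"
  shows "\<exists>ix :: nat \<Rightarrow> nat \<Rightarrow> nat set \<Rightarrow> nat. \<forall>i j. i < j \<and> j < k \<longrightarrow>
    inj_on (ix i j) {S. S \<subseteq> {..<k} \<and> card S = r \<and> i \<in> S \<and> j \<in> S} \<and>
    ix i j ` {S. S \<subseteq> {..<k} \<and> card S = r \<and> i \<in> S \<and> j \<in> S} \<subseteq> {..<(k - 2) choose (r - 2)}"
proof -
  define X where "X i j = {S. S \<subseteq> {..<k} \<and> card S = r \<and> i \<in> S \<and> j \<in> S}" for i j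
  define ix where "ix i j = (SOME f. bij_betw f (X i j) {0..<card (X i j)})" for i j
  have "inj_on (ix i j) (X i j) \<and> ix i j ` X i j \<subseteq> {..<(k - 2) choose (r - 2)}" if ij: "i < j" "j < k" for i j
  proof -
    have fin: "finite (X i j)" unfolding X_def by (rule finite_subset[of _ "Pow {..<k}"]) auto
    have "bij_betw (ix i j) (X i j) {0..<card (X i j)}"
      unfolding ix_def by (rule someI_ex[OF ex_bij_betw_finite_nat[OF fin]])
    moreover have "card (X i j) = (k - 2) choose (r - 2)"
      unfolding X_def using ij assms by (intro card_subsets_containing_pair) auto
    ultimately show ?thesis by (simp add: bij_betw_def lessThan_atLeast0)
  qed
  then show ?thesis unfolding X_def by (intro exI[of _ ix] allI impI) (elim conjE)
qed

text \<open>Vertices are pairs of a part \<open>i < k\<close> and a vector of residues modulo \<open>q\<close> indexed by \<open>coords\<close>.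
  Over \<open>S\<close>, the edges are the points \<open>pt\<close> with \<open>i \<in> S\<close> on lines with one slope per coordinate. The
  linear form with coefficients \<open>w i j\<close> sends the difference of the points in parts \<open>i\<close> and \<open>j\<close> to \<open>C\<close>
  times the sum of the slopes plus a constant, and the shifts \<open>s\<close> are chosen so that
  this value is \<open>C\<^sup>2 * (mu * m + ix i j S)\<close>. Hence a pair of vertices determines \<open>m\<close> and \<open>S\<close>, then the slopes,
  then the line. Only differences of absolute value at most \<open>k\<close> are inverted, whence \<open>C = k!\<close>
  and the hypothesis that \<open>q\<close> is coprime to it; no finite field is needed. The second
  coordinate family \<open>pairs\<close> has \<open>k\<close> in place of one parameter, which lets
  the shift belonging to one pair of parts act on no other pair.\<close>

locale packing =
  fixes k r q :: nat and ix :: "nat \<Rightarrow> nat \<Rightarrow> nat set \<Rightarrow> nat" and mu :: nat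
  assumes r: "2 \<le> r" "r \<le> k" and q: "coprime q (fact k)" "0 < q" and mu: "0 < mu"
    and ix_inj: "\<And>i j S S'. i < j \<Longrightarrow> j < k \<Longrightarrow> S \<subseteq> {..<k} \<Longrightarrow> card S = r \<Longrightarrow> i \<in> S \<Longrightarrow> j \<in> S \<Longrightarrow>
        S' \<subseteq> {..<k} \<Longrightarrow> card S' = r \<Longrightarrow> i \<in> S' \<Longrightarrow> j \<in> S' \<Longrightarrow> ix i j S = ix i j S' \<Longrightarrow> S = S'"
    and ix_less: "\<And>i j S. i < j \<Longrightarrow> j < k \<Longrightarrow> S \<subseteq> {..<k} \<Longrightarrow> card S = r \<Longrightarrow> i \<in> S \<Longrightarrow> j \<in> S \<Longrightarrow> ix i j S < mu"
begin

definition pairs :: "(nat \<times> nat) set" where "pairs = (SIGMA i:{..<k}. {i<..<k})"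
text \<open>Members of \<open>pairs\<close> have increasing components, so \<open>(0, 0)\<close> is
  a new coordinate. There every part keeps its own parameter; slope and shift at this coordinate are
  not free but balance those at all others.\<close>

definition coords :: "(nat \<times> nat) set" where "coords = insert (0, 0) pairs"
definition C :: int where "C = fact k"

definition \<theta> :: "nat \<Rightarrow> nat \<times> nat \<Rightarrow> int" where
  "\<theta> i l = (if l \<noteq> (0, 0) \<and> i = snd l then int k else int i)"

definition w :: "nat \<Rightarrow> nat \<Rightarrow> nat \<times> nat \<Rightarrow> int" where
  "w i j l = C div (\<theta> i l - \<theta> j l)"

text \<open>The solution of a linear equation. At the coordinate \<open>(i, j)\<close> the parameter
  k replaces j, so the coefficient is C/(i-k) instead of C/(i-j), a change of C(k-j)/((i-k)(i-j)).
  The shift times this change has to be \<open>C^2 * ix i j S\<close>; only k-j gets inverted, by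
  means of \<open>C\<close>.\<close>

definition t :: "nat set \<Rightarrow> nat \<Rightarrow> nat \<Rightarrow> int" where
  "t S i j = int (ix i j S) * (int i - int k) * (int i - int j) * (C div (int k - int j))"

text \<open>The shifts of each part sum to zero over \<open>coords\<close>. For \<open>i < j\<close>
  the coefficient \<open>w i j\<close> is \<open>C div (int i - int j)\<close> at every coordinate
  where part \<open>i\<close> or part \<open>j\<close> is shifted, except at \<open>(i, j)\<close>;
  so everything cancels but the effect of \<open>t S i j\<close> there.\<close>

definition s :: "nat set \<Rightarrow> nat \<Rightarrow> nat \<times> nat \<Rightarrow> int" where
  "s S i l = (if l = (0, 0) then - (\<Sum>j\<in>{i<..<k}. t S i j) else if i = fst l then t S i (snd l) else 0)"

text \<open>The entry at \<open>(0, 0)\<close> forces the sum of the slopes to be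
  \<open>C * mu * m\<close>, so that \<open>m\<close> takes the place of the last free
  slope.\<close>

definition slope :: "(nat \<times> nat \<Rightarrow> int) \<Rightarrow> nat \<Rightarrow> nat \<times> nat \<Rightarrow> int" where
  "slope \<gamma> m l = (if l = (0, 0) then C * int mu * int m - (\<Sum>l\<in>pairs. \<gamma> l) else \<gamma> l)"

definition pt :: "nat set \<Rightarrow> (nat \<times> nat \<Rightarrow> int) \<Rightarrow> (nat \<times> nat \<Rightarrow> int) \<Rightarrow> nat \<Rightarrow> nat \<Rightarrow> nat \<times> nat \<Rightarrow> int" where
  "pt S h \<gamma> m i l = h l + s S i l + slope \<gamma> m l * \<theta> i l"

lemma finite_pairs: "finite pairs" and star_notin: "(0, 0) \<notin> pairs"
  by (auto simp: pairs_def)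

lemma dvd_C: "x \<noteq> 0 \<Longrightarrow> \<bar>x\<bar> \<le> int k \<Longrightarrow> x dvd C"
proof -
  assume x: "x \<noteq> 0" "\<bar>x\<bar> \<le> int k"
  have "nat \<bar>x\<bar> dvd fact k" using x by (intro dvd_fact) auto
  then have "int (nat \<bar>x\<bar>) dvd int (fact k)" by (simp only: of_nat_dvd_iff)
  then show "x dvd C" by (simp add: C_def)
qed

lemma coprime_C: "coprime (int q) C"
  using q(1) unfolding C_def by (metis coprime_int_iff of_nat_fact)

lemma div_C: "x \<noteq> 0 \<Longrightarrow> \<bar>x\<bar> \<le> int k \<Longrightarrow> (C div x) * x = C"
  by (simp add: dvd_C)

lemma \<theta>_diff: "i < k \<Longrightarrow> j < k \<Longrightarrow> i \<noteq> j \<Longrightarrow> \<theta> i l - \<theta> j l \<noteq> 0 \<and> \<bar>\<theta> i l - \<theta> j l\<bar> \<le> int k"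
  by (auto simp: \<theta>_def)

lemma w_\<theta>: "i < k \<Longrightarrow> j < k \<Longrightarrow> i \<noteq> j \<Longrightarrow> w i j l * (\<theta> i l - \<theta> j l) = C"
  unfolding w_def using \<theta>_diff div_C by blast

lemma sum_coords: "(\<Sum>l\<in>coords. f l) = f (0, 0) + (\<Sum>a<k. \<Sum>b\<in>{a<..<k}. f (a, b))" for f :: "nat \<times> nat \<Rightarrow> int"
proof -
  have "(\<Sum>l\<in>coords. f l) = f (0, 0) + (\<Sum>l\<in>pairs. f l)"
    unfolding coords_def using finite_pairs star_notin by simp
  also have "(\<Sum>l\<in>pairs. f l) = (\<Sum>a<k. \<Sum>b\<in>{a<..<k}. f (a, b))"
    unfolding pairs_def by (subst sum.Sigma) (auto simp: case_prod_beta)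
  finally show ?thesis .
qed

lemma sum_slope: "(\<Sum>l\<in>coords. slope \<gamma> m l) = C * int mu * int m"
proof -
  have "(\<Sum>l\<in>coords. slope \<gamma> m l) = slope \<gamma> m (0, 0) + (\<Sum>l\<in>pairs. slope \<gamma> m l)"
    unfolding coords_def using finite_pairs star_notin by simp
  also have "(\<Sum>l\<in>pairs. slope \<gamma> m l) = (\<Sum>l\<in>pairs. \<gamma> l)"
    using star_notin by (intro sum.cong refl) (auto simp: slope_def)
  finally show ?thesis by (simp add: slope_def)
qed

lemma sum_w_s:
  assumes ij: "i < j" "j < k"
  shows "(\<Sum>l\<in>coords. w i j l * (s S i l - s S j l)) = C^2 * int (ix i j S)"
proof -
  define B where "B = C div (int i - int j)"
  define A where "A = C div (int i - int k)"
  define E where "E = C div (int k - int j)"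
  have w0: "w i j (0, 0) = B" by (simp add: w_def \<theta>_def B_def)
  have wi: "w i j (i, b) = (if b = j then A else B)" if "i < b" for b
    using that ij by (auto simp: w_def \<theta>_def A_def B_def)
  have wj: "w i j (j, b) = B" if "j < b" for b
    using that ij by (auto simp: w_def \<theta>_def B_def)
  have s0: "s S i (0, 0) - s S j (0, 0) = (\<Sum>b\<in>{j<..<k}. t S j b) - (\<Sum>b\<in>{i<..<k}. t S i b)"
    by (simp add: s_def)
  have inner: "(\<Sum>b\<in>{a<..<k}. w i j (a, b) * (s S i (a, b) - s S j (a, b))) =
     (if a = i then (\<Sum>b\<in>{i<..<k}. B * t S i b) + (A - B) * t S i j else 0) +
     (if a = j then - (\<Sum>b\<in>{j<..<k}. B * t S j b) else 0)" for a
  proof (cases "a = i")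
    case True
    have "(\<Sum>b\<in>{a<..<k}. w i j (a, b) * (s S i (a, b) - s S j (a, b))) =
       (\<Sum>b\<in>{i<..<k}. B * t S i b + (if b = j then (A - B) * t S i j else 0))"
      using True ij wi by (intro sum.cong) (auto simp: s_def algebra_simps)
    also have "\<dots> = (\<Sum>b\<in>{i<..<k}. B * t S i b) + (A - B) * t S i j"
      using ij by (simp add: sum.distrib)
    finally show ?thesis using True ij by simp
  next
    case False
    show ?thesis
    proof (cases "a = j")
      case True
      have "(\<Sum>b\<in>{a<..<k}. w i j (a, b) * (s S i (a, b) - s S j (a, b))) = (\<Sum>b\<in>{j<..<k}. - (B * t S j b))"
        using True ij wj by (intro sum.cong) (auto simp: s_def)
      then show ?thesis using True False by (simp add: sum_negf)
    next
      case aj: False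
      have "(\<Sum>b\<in>{a<..<k}. w i j (a, b) * (s S i (a, b) - s S j (a, b))) = 0"
        using False aj by (intro sum.neutral) (auto simp: s_def)
      then show ?thesis using False aj by simp
    qed
  qed
  have "(\<Sum>a<k. \<Sum>b\<in>{a<..<k}. w i j (a, b) * (s S i (a, b) - s S j (a, b))) =
     (\<Sum>b\<in>{i<..<k}. B * t S i b) + (A - B) * t S i j - (\<Sum>b\<in>{j<..<k}. B * t S j b)"
    unfolding inner using ij by (simp add: sum.distrib)
  then have "(\<Sum>l\<in>coords. w i j l * (s S i l - s S j l)) = (A - B) * t S i j"
    unfolding sum_coords w0 s0 by (simp add: sum_distrib_left[symmetric] right_diff_distrib)
  also have "\<dots> = int (ix i j S) * E * ((A * (int i - int k)) * (int i - int j) - (B * (int i - int j)) * (int i - int k))"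
    by (simp add: t_def E_def algebra_simps)
  also have "A * (int i - int k) = C" unfolding A_def using ij by (intro div_C) auto
  also have "B * (int i - int j) = C" unfolding B_def using ij by (intro div_C) auto
  also have "int (ix i j S) * E * (C * (int i - int j) - C * (int i - int k)) =
      int (ix i j S) * C * (E * (int k - int j))"
    by (simp add: algebra_simps)
  also have "E * (int k - int j) = C" unfolding E_def using ij by (intro div_C) auto
  finally show ?thesis by (simp add: power2_eq_square)
qed

lemma sum_w_pt:
  assumes ij: "i < j" "j < k"
  shows "(\<Sum>l\<in>coords. w i j l * (pt S h \<gamma> m i l - pt S h \<gamma> m j l)) = C^2 * int (mu * m + ix i j S)"
proof -
  have eq: "w i j l * (pt S h \<gamma> m i l - pt S h \<gamma> m j l) = w i j l * (s S i l - s S j l) + C * slope \<gamma> m l" for l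
  proof -
    have "w i j l * (pt S h \<gamma> m i l - pt S h \<gamma> m j l) =
        w i j l * (s S i l - s S j l) + w i j l * (\<theta> i l - \<theta> j l) * slope \<gamma> m l"
      by (simp add: pt_def algebra_simps)
    also have "w i j l * (\<theta> i l - \<theta> j l) = C" using ij by (intro w_\<theta>) auto
    finally show ?thesis .
  qed
  show ?thesis unfolding eq sum.distrib sum_w_s[OF ij] sum_distrib_left[symmetric] sum_slope
    by (simp add: power2_eq_square algebra_simps)
qed

text \<open>Taking \<open>m\<close> below \<open>q div mu\<close> keeps
  \<open>mu * m + ix i j S\<close> below \<open>q\<close>, so that congruent values are equal. Fewer
  than \<open>mu\<close> residues are wasted.\<close>

definition params :: "(nat set \<times> (nat \<times> nat \<Rightarrow> int) \<times> (nat \<times> nat \<Rightarrow> int) \<times> nat) set" where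
  "params = {S. S \<subseteq> {..<k} \<and> card S = r} \<times> (coords \<rightarrow>\<^sub>E {0..<int q}) \<times> (pairs \<rightarrow>\<^sub>E {0..<int q}) \<times> {..<q div mu}"

definition vtx :: "nat set \<times> (nat \<times> nat \<Rightarrow> int) \<times> (nat \<times> nat \<Rightarrow> int) \<times> nat \<Rightarrow> nat \<Rightarrow> nat \<times> (nat \<times> nat \<Rightarrow> int)" where
  "vtx = (\<lambda>(S, h, \<gamma>, m) i. (i, restrict (\<lambda>l. pt S h \<gamma> m i l mod int q) coords))"

definition verts :: "(nat \<times> (nat \<times> nat \<Rightarrow> int)) set" where
  "verts = {..<k} \<times> (coords \<rightarrow>\<^sub>E {0..<int q})"

section \<open>Size and linearity of the packing\<close>

lemma finite_coords: "finite coords" and card_coords: "card coords = Suc (card pairs)"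
  using finite_pairs star_notin by (auto simp: coords_def)

lemma card_verts: "finite verts" "card verts = k * q ^ card coords"
  using finite_coords by (auto simp: verts_def card_cartesian_product card_PiE intro: finite_PiE)

lemma card_params: "finite params" "card params = (k choose r) * q ^ card coords * q ^ card pairs * (q div mu)"
proof -
  have "finite {S. S \<subseteq> {..<k} \<and> card S = r}" by (rule finite_subset[of _ "Pow {..<k}"]) auto
  then show "finite params" unfolding params_def using finite_coords finite_pairs
    by (intro finite_cartesian_product finite_PiE) auto
  show "card params = (k choose r) * q ^ card coords * q ^ card pairs * (q div mu)"
    unfolding params_def using finite_coords finite_pairs
    by (simp add: card_cartesian_product card_PiE n_subsets)
qed

lemma vtx_in_verts:
  assumes "p \<in> params" "i \<in> fst p"
  shows "vtx p i \<in> verts"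
  using assms q(2) by (auto simp: vtx_def verts_def params_def)

lemma params_eqI_less:
  assumes p: "p \<in> params" and p': "p' \<in> params" and ij: "i < j" and i: "i \<in> fst p" "i \<in> fst p'"
    and j: "j \<in> fst p" "j \<in> fst p'" and eq: "vtx p i = vtx p' i" "vtx p j = vtx p' j"
  shows "p = p'"
proof -
  obtain S h \<gamma> m where pe: "p = (S, h, \<gamma>, m)" by (cases p)
  obtain S' h' \<gamma>' m' where pe': "p' = (S', h', \<gamma>', m')" by (cases p')
  have S: "S \<subseteq> {..<k}" "card S = r" "i \<in> S" "j \<in> S" and S': "S' \<subseteq> {..<k}" "card S' = r" "i \<in> S'" "j \<in> S'"
    and m: "m < q div mu" "m' < q div mu" and h: "h \<in> coords \<rightarrow>\<^sub>E {0..<int q}" "h' \<in> coords \<rightarrow>\<^sub>E {0..<int q}"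
    and \<gamma>: "\<gamma> \<in> pairs \<rightarrow>\<^sub>E {0..<int q}" "\<gamma>' \<in> pairs \<rightarrow>\<^sub>E {0..<int q}"
    using p p' i j by (auto simp: pe pe' params_def)
  have jk: "j < k" "i < k" using S by auto
  have cong: "[pt S h \<gamma> m a l = pt S' h' \<gamma>' m' a l] (mod int q)" if "a = i \<or> a = j" "l \<in> coords" for a l
  proof -
    have "restrict (\<lambda>l. pt S h \<gamma> m a l mod int q) coords = restrict (\<lambda>l. pt S' h' \<gamma>' m' a l mod int q) coords"
      using eq that(1) by (auto simp: vtx_def pe pe')
    from fun_cong[OF this, of l] show ?thesis using that(2) by (simp add: cong_def)
  qed
  have "[(\<Sum>l\<in>coords. w i j l * (pt S h \<gamma> m i l - pt S h \<gamma> m j l)) =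
        (\<Sum>l\<in>coords. w i j l * (pt S' h' \<gamma>' m' i l - pt S' h' \<gamma>' m' j l))] (mod int q)"
    by (intro cong_sum cong_mult cong_refl cong_diff cong) auto
  then have "[C^2 * int (mu * m + ix i j S) = C^2 * int (mu * m' + ix i j S')] (mod int q)"
    unfolding sum_w_pt[OF ij jk(1)] .
  then have "[int (mu * m + ix i j S) = int (mu * m' + ix i j S')] (mod int q)"
    using coprime_C by (subst (asm) cong_mult_lcancel) (auto simp: coprime_commute)
  then have "[mu * m + ix i j S = mu * m' + ix i j S'] (mod q)"
    by (simp only: cong_int_iff)
  moreover have "mu * m + ix i j S < q" "mu * m' + ix i j S' < q"
  proof -
    have "mu * n + x < q" if "n < q div mu" "x < mu" for n x
    proof -
      have "mu * n + x < mu * Suc n" using that by simp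
      also have "\<dots> \<le> mu * (q div mu)" using that by (intro mult_left_mono) auto
      also have "\<dots> \<le> q" by simp
      finally show ?thesis .
    qed
    then show "mu * m + ix i j S < q" "mu * m' + ix i j S' < q"
      using m ix_less[OF ij jk(1) S] ix_less[OF ij jk(1) S'] by auto
  qed
  ultimately have eqn: "mu * m + ix i j S = mu * m' + ix i j S'"
    by (simp add: cong_def)
  have lt: "ix i j S < mu" "ix i j S' < mu"
    using ix_less[OF ij jk(1) S] ix_less[OF ij jk(1) S'] by auto
  have mm: "m = m'" using arg_cong[OF eqn, of "\<lambda>x. x div mu"] lt mu by simp
  then have "S = S'" using eqn ix_inj[OF ij jk(1) S S'] by simp
  note pt_eq = cong[unfolded \<open>S = S'\<close> \<open>m = m'\<close>]
  have slope_cong: "[slope \<gamma> m' l = slope \<gamma>' m' l] (mod int q)" if "l \<in> coords" for l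
  proof -
    let ?d = "\<theta> i l - \<theta> j l"
    have "[pt S' h \<gamma> m' i l - pt S' h \<gamma> m' j l = pt S' h' \<gamma>' m' i l - pt S' h' \<gamma>' m' j l] (mod int q)"
      using that by (intro cong_diff pt_eq) auto
    then have "[?d * slope \<gamma> m' l + (s S' i l - s S' j l) = ?d * slope \<gamma>' m' l + (s S' i l - s S' j l)] (mod int q)"
      by (simp add: pt_def algebra_simps)
    then have "[?d * slope \<gamma> m' l = ?d * slope \<gamma>' m' l] (mod int q)" by (simp only: cong_add_rcancel)
    moreover have "coprime ?d (int q)"
    proof -
      have "?d dvd C" using \<theta>_diff[OF jk(2,1), of l] ij by (intro dvd_C) auto
      then show ?thesis
        using coprime_divisors[of ?d C "int q" "int q"] coprime_C by (simp add: coprime_commute)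
    qed
    ultimately show ?thesis by (simp add: cong_mult_lcancel)
  qed
  have small_eq: "a = b" if "[a = b] (mod int q)" "a \<in> {0..<int q}" "b \<in> {0..<int q}" for a b
    using that by (simp add: cong_def)
  have "\<gamma> l = \<gamma>' l" if "l \<in> pairs" for l
  proof (rule small_eq)
    have "l \<noteq> (0, 0)" using that star_notin by auto
    then show "[\<gamma> l = \<gamma>' l] (mod int q)" using slope_cong[of l] that by (auto simp: slope_def coords_def)
  qed (use \<gamma> that in \<open>auto simp: PiE_iff\<close>)
  then have g: "\<gamma> = \<gamma>'" by (rule PiE_ext[OF \<gamma>])
  have "h l = h' l" if "l \<in> coords" for l
  proof (rule small_eq)
    have "[h l + (s S' i l + slope \<gamma>' m' l * \<theta> i l) = h' l + (s S' i l + slope \<gamma>' m' l * \<theta> i l)] (mod int q)"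
      using pt_eq[of i l] that by (simp add: pt_def g add.assoc)
    then show "[h l = h' l] (mod int q)" by (simp only: cong_add_rcancel)
  qed (use h that in \<open>auto simp: PiE_iff\<close>)
  then have "h = h'" by (rule PiE_ext[OF h])
  with g \<open>S = S'\<close> mm show ?thesis by (simp add: pe pe')
qed

lemma params_eqI:
  assumes "p \<in> params" "p' \<in> params" "x \<noteq> y" "{x, y} \<subseteq> vtx p ` fst p" "{x, y} \<subseteq> vtx p' ` fst p'"
  shows "p = p'"
proof -
  have fst_vtx: "fst (vtx p i) = i" for p i by (auto simp: vtx_def split: prod.split)
  obtain i j where ij: "i \<in> fst p" "j \<in> fst p" "x = vtx p i" "y = vtx p j" using assms(4) by auto
  obtain i' j' where ij': "i' \<in> fst p'" "j' \<in> fst p'" "x = vtx p' i'" "y = vtx p' j'" using assms(5) by auto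
  have e: "i' = i" "j' = j" using ij ij' fst_vtx by metis+
  have vi: "vtx p i = vtx p' i" "vtx p j = vtx p' j" and m: "i \<in> fst p'" "j \<in> fst p'"
    using ij ij' e by auto
  have "i \<noteq> j" using assms(3) ij by auto
  then consider "i < j" | "j < i" by linarith
  then show ?thesis
  proof cases
    case 1
    then show ?thesis using params_eqI_less[OF assms(1,2) 1 ij(1) m(1) ij(2) m(2) vi] by simp
  next
    case 2
    then show ?thesis using params_eqI_less[OF assms(1,2) 2 ij(2) m(2) ij(1) m(1) vi(2,1)] by simp
  qed
qed

lemma exists_partite_packing:
  assumes "k * q ^ card coords \<le> n"
  shows "\<exists>H col. uniform_hypergraph n r H \<and> linear_hypergraph H \<and> (\<forall>e\<in>H. inj_on col e \<and> col ` e \<subseteq> {..<k}) \<and>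
    card H = (k choose r) * q ^ card coords * q ^ card pairs * (q div mu)"
proof -
  have "card verts \<le> card {..<n}" using assms card_verts by simp
  then obtain f where f: "inj_on f verts" "f ` verts \<subseteq> {..<n}"
    using card_le_inj[OF card_verts(1), of "{..<n}"] by auto
  define g where "g p = f ` vtx p ` fst p" for p
  have fst_vtx: "fst (vtx p i) = i" for p i by (auto simp: vtx_def split: prod.split)
  have vv: "vtx p ` fst p \<subseteq> verts" if "p \<in> params" for p using vtx_in_verts[OF that] by blast
  have inj_vtx: "inj_on (vtx p) A" for p A by (rule inj_on_inverseI[of _ fst]) (rule fst_vtx)
  have cfst: "card (fst p) = r" "fst p \<subseteq> {..<k}" if "p \<in> params" for p using that by (auto simp: params_def)
  have cg: "card (g p) = r" if "p \<in> params" for p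
    unfolding g_def using cfst[OF that] inj_vtx inj_on_subset[OF f(1) vv[OF that]] by (simp add: card_image)
  have share: "p = p'" if p: "p \<in> params" "p' \<in> params" and c: "\<not> card (g p \<inter> g p') \<le> 1" for p p'
  proof -
    have int: "g p \<inter> g p' = f ` (vtx p ` fst p \<inter> vtx p' ` fst p')"
      unfolding g_def using inj_on_image_Int[OF f(1) vv[OF p(1)] vv[OF p(2)]] by simp
    let ?X = "vtx p ` fst p \<inter> vtx p' ` fst p'"
    have "finite (fst p)" using cfst(2)[OF p(1)] finite_subset by blast
    then have "card (g p \<inter> g p') \<le> card ?X" unfolding int by (intro card_image_le) auto
    then have "\<not> card ?X \<le> 1" using c by simp
    have "finite ?X" using \<open>finite (fst p)\<close> by simp
    have "\<exists>x\<in>?X. \<exists>y\<in>?X. x \<noteq> y"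
    proof (rule ccontr)
      assume "\<not> ?thesis"
      then have "\<forall>x\<in>?X. \<forall>y\<in>?X. x = y" by (simp only: bex_simps ball_simps not_not simp_thms)
      then have "card ?X \<le> Suc 0" by (simp only: card_le_Suc0_iff_eq[OF \<open>finite ?X\<close>])
      then show False using \<open>\<not> card ?X \<le> 1\<close> by simp
    qed
    then obtain x y where xy: "x \<in> ?X" "y \<in> ?X" "x \<noteq> y" by (elim bexE)
    have "{x, y} \<subseteq> vtx p ` fst p" "{x, y} \<subseteq> vtx p' ` fst p'" using xy(1,2) by (simp_all only: Int_iff insert_subset empty_subsetI)
    then show ?thesis by (rule params_eqI[OF p xy(3)])
  qed
  have inj_g: "inj_on g params"
  proof (rule inj_onI)
    fix p p' assume p: "p \<in> params" "p' \<in> params" "g p = g p'"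
    then have "card (g p \<inter> g p') = r" using cg by simp
    then show "p = p'" using share[OF p(1,2)] r by simp
  qed
  define col where "col x = fst (inv_into verts f x)" for x
  have col: "col (f v) = fst v" if "v \<in> verts" for v
    using f(1) that by (simp add: col_def)
  show ?thesis
  proof (intro exI[of _ "g ` params"] exI[of _ col] conjI ballI)
    show "uniform_hypergraph n r (g ` params)"
      unfolding uniform_hypergraph_def
    proof (intro ballI conjI)
      fix e assume "e \<in> g ` params"
      then obtain p where p: "p \<in> params" "e = g p" by (elim imageE)
      show "card e = r" using cg[OF p(1)] p(2) by simp
      show "e \<subseteq> {..<n}" unfolding p(2) g_def using vv[OF p(1)] f(2) by blast
    qed
    show "linear_hypergraph (g ` params)"
      unfolding linear_hypergraph_def
    proof (intro ballI impI)
      fix e e' assume "e \<in> g ` params" "e' \<in> g ` params" "e \<noteq> e'"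
      then obtain p p' where "p \<in> params" "p' \<in> params" "e = g p" "e' = g p'" "p \<noteq> p'" by blast
      then show "card (e \<inter> e') \<le> 1" using share[of p p'] by (cases "card (e \<inter> e') \<le> 1") simp_all
    qed
    show "card (g ` params) = (k choose r) * q ^ card coords * q ^ card pairs * (q div mu)"
      using inj_g card_params(2) by (simp add: card_image)
  next
    fix e assume "e \<in> g ` params"
    then obtain p where p: "p \<in> params" "e = g p" by (elim imageE)
    have colv: "col (f (vtx p i)) = i" if "i \<in> fst p" for i
      using col[of "vtx p i"] vtx_in_verts[OF p(1) that] fst_vtx by simp
    show "inj_on col e" unfolding p(2) g_def image_image
    proof (rule inj_onI)
      fix x y assume "x \<in> (\<lambda>i. f (vtx p i)) ` fst p" "y \<in> (\<lambda>i. f (vtx p i)) ` fst p" "col x = col y"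
      then show "x = y" by (elim imageE) (simp add: colv)
    qed
    show "col ` e \<subseteq> {..<k}" unfolding p(2) g_def image_image using colv cfst(2)[OF p(1)] by (simp add: subset_iff)
  qed
qed

end

text \<open>\<open>d\<close> is the number of pairs of parts and depends on \<open>k\<close> alone,
  so \<open>q\<close> may grow with \<open>n\<close>. A part has N = q^(d+1) vertices, and each
  r-set through two given parts uses about N^2 / (k-2 choose r-2) of the vertex pairs between them.
  Together these r-sets cover almost all pairs.\<close>

theorem partite_packing:
  assumes r: "2 \<le> r" "r \<le> k"
  shows "\<exists>d. \<forall>q n. 0 < q \<and> coprime q (fact k) \<and> k * q ^ Suc d \<le> n \<longrightarrow>
    (\<exists>H col. uniform_hypergraph n r H \<and> linear_hypergraph H \<and> (\<forall>e\<in>H. inj_on col e \<and> col ` e \<subseteq> {..<k}) \<and>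
    card H = (k choose r) * q ^ Suc d * q ^ d * (q div ((k - 2) choose (r - 2))))"
proof -
  obtain ix :: "nat \<Rightarrow> nat \<Rightarrow> nat set \<Rightarrow> nat" where ix: "\<forall>i j. i < j \<and> j < k \<longrightarrow>
    inj_on (ix i j) {S. S \<subseteq> {..<k} \<and> card S = r \<and> i \<in> S \<and> j \<in> S} \<and>
    ix i j ` {S. S \<subseteq> {..<k} \<and> card S = r \<and> i \<in> S \<and> j \<in> S} \<subseteq> {..<(k - 2) choose (r - 2)}"
    using exists_pair_index[OF r(1), of k] by (elim exE)
  show ?thesis
  proof (intro exI[of _ "card (SIGMA i:{..<k}. {i<..<k})"] allI impI)
    fix q n :: nat
    assume *: "0 < q \<and> coprime q (fact k) \<and> k * q ^ Suc (card (SIGMA i:{..<k}. {i<..<k})) \<le> n"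
    interpret packing k r q ix "(k - 2) choose (r - 2)"
    proof
      fix i j S S'
      assume "i < j" "j < k" "S \<subseteq> {..<k}" "card S = r" "i \<in> S" "j \<in> S"
        "S' \<subseteq> {..<k}" "card S' = r" "i \<in> S'" "j \<in> S'" "ix i j S = ix i j S'"
      moreover from this have "inj_on (ix i j) {S. S \<subseteq> {..<k} \<and> card S = r \<and> i \<in> S \<and> j \<in> S}" using ix by blast
      ultimately show "S = S'" by (auto dest: inj_onD)
    next
      fix i j S
      assume "i < j" "j < k" "S \<subseteq> {..<k}" "card S = r" "i \<in> S" "j \<in> S"
      moreover from this have "ix i j ` {S. S \<subseteq> {..<k} \<and> card S = r \<and> i \<in> S \<and> j \<in> S} \<subseteq> {..<(k - 2) choose (r - 2)}"
        using ix by blast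
      ultimately show "ix i j S < (k - 2) choose (r - 2)" by blast
    qed (use r * in auto)
    have "k * q ^ card coords \<le> n" using * by (simp only: card_coords pairs_def)
    from exists_partite_packing[OF this]
    show "\<exists>H col. uniform_hypergraph n r H \<and> linear_hypergraph H \<and> (\<forall>e\<in>H. inj_on col e \<and> col ` e \<subseteq> {..<k}) \<and>
      card H = (k choose r) * q ^ Suc (card (SIGMA i:{..<k}. {i<..<k})) * q ^ card (SIGMA i:{..<k}. {i<..<k}) * (q div ((k - 2) choose (r - 2)))"
      by (simp only: card_coords pairs_def)
  qed
qed

section \<open>Asymptotics\<close>

lemma exists_proper_colouring_chromatic_number:
  assumes "simple_graph V E"
  shows "\<exists>c. proper_colouring V E c (chromatic_number V E)"
proof -
  have "finite V" using assms by (simp add: simple_graph_def)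
  then obtain f where f: "bij_betw f V {0..<card V}" using ex_bij_betw_finite_nat by blast
  have "proper_colouring V E f (card V)"
    unfolding proper_colouring_def
  proof (intro conjI ballI impI)
    show "f v < card V" if "v \<in> V" for v
      using bij_betwE[OF f] that by auto
    fix e u v assume "e \<in> E" "u \<in> e" "v \<in> e" "u \<noteq> v"
    moreover have "e \<subseteq> V" using assms \<open>e \<in> E\<close> by (auto simp: simple_graph_def)
    ultimately show "f u \<noteq> f v" using f by (auto simp: bij_betw_def inj_on_def)
  qed
  then show ?thesis
    unfolding chromatic_number_def by (intro LeastI[of "\<lambda>k. \<exists>c. proper_colouring V E c k" "card V"] exI[of _ f])
qed

text \<open>A copy of the expansion would pull the colouring \<open>col\<close> of the parts back to
  a proper colouring of the graph.\<close>

lemma not_contains_expansion_of_partite: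
  assumes "0 < k" "\<not> (\<exists>c. proper_colouring V E c k)" "\<forall>e\<in>H. inj_on col e \<and> col ` e \<subseteq> {..<k}" "simple_graph V E"
  shows "\<not> contains_expansion V E H"
proof
  assume "contains_expansion V E H"
  then obtain \<phi> g where \<phi>: "inj_on \<phi> V"
    and "\<forall>e\<in>E. g e \<in> H \<and> \<phi> ` e \<subseteq> g e \<and> (g e - \<phi> ` e) \<inter> \<phi> ` V = {}"
    unfolding contains_expansion_def by (elim exE conjE)
  then have g: "g e \<in> H \<and> \<phi> ` e \<subseteq> g e" if "e \<in> E" for e using that by simp
  \<comment> \<open>The default 0 serves isolated vertices of the graph, whose images may lie in no
    edge and have a colour outside \<open>{..<k}\<close>.\<close>
  define c where "c v = (if col (\<phi> v) < k then col (\<phi> v) else 0)" for v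
  have "proper_colouring V E c k"
    unfolding proper_colouring_def
  proof (intro conjI ballI impI)
    show "c v < k" for v using assms(1) by (simp add: c_def)
    fix e u v assume e: "e \<in> E" "u \<in> e" "v \<in> e" "u \<noteq> v"
    have "e \<subseteq> V" using assms(4) e(1) by (auto simp: simple_graph_def)
    then have "\<phi> u \<noteq> \<phi> v" using \<phi> e by (auto simp: inj_on_def)
    have in_g: "\<phi> u \<in> g e" "\<phi> v \<in> g e" using g[OF e(1)] e by auto
    have col: "inj_on col (g e)" "col ` g e \<subseteq> {..<k}" using assms(3) g[OF e(1)] by auto
    have "col (\<phi> u) \<noteq> col (\<phi> v)" using col(1) in_g \<open>\<phi> u \<noteq> \<phi> v\<close> by (auto simp: inj_on_def)
    moreover have "col (\<phi> u) < k" "col (\<phi> v) < k" using col(2) in_g by auto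
    ultimately show "c u \<noteq> c v" by (simp add: c_def)
  qed
  then show False using assms(2) by blast
qed

text \<open>As \<open>E\<close> is non-empty, the empty hypergraph contains no expansion, so the
  supremum ranges over a non-empty set.\<close>

lemma ex_lin_q_le:
  assumes "E \<noteq> {}" "\<And>H. uniform_hypergraph n r H \<Longrightarrow> linear_hypergraph H \<Longrightarrow> \<not> contains_expansion V E H \<Longrightarrow> signless_q n r H \<le> c"
  shows "ex_lin_q r V E n \<le> c"
  unfolding ex_lin_q_def
proof (rule cSup_least)
  have "uniform_hypergraph n r {} \<and> linear_hypergraph {} \<and> \<not> contains_expansion V E {}"
    using assms(1) by (auto simp: uniform_hypergraph_def linear_hypergraph_def contains_expansion_def)
  then have "signless_q n r {} \<in> {signless_q n r H | H. uniform_hypergraph n r H \<and> linear_hypergraph H \<and> \<not> contains_expansion V E H}"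
    by (intro CollectI exI[of _ "{}"]) simp
  then show "{signless_q n r H | H. uniform_hypergraph n r H \<and> linear_hypergraph H \<and> \<not> contains_expansion V E H} \<noteq> {}"
    by (metis empty_iff)
next
  fix s assume "s \<in> {signless_q n r H | H. uniform_hypergraph n r H \<and> linear_hypergraph H \<and> \<not> contains_expansion V E H}"
  then show "s \<le> c" using assms(2) by (elim CollectE exE conjE) simp
qed

lemma ex_lin_q_ge:
  assumes "0 < n" "2 \<le> r" and H: "uniform_hypergraph n r H" "linear_hypergraph H" "\<not> contains_expansion V E H"
  shows "signless_q n r H \<le> ex_lin_q r V E n"
  unfolding ex_lin_q_def
proof (rule cSup_upper)
  show "signless_q n r H \<in> {signless_q n r H | H. uniform_hypergraph n r H \<and> linear_hypergraph H \<and> \<not> contains_expansion V E H}"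
    using H by (intro CollectI exI[of _ H]) simp
  have le: "signless_q n r H \<le> 2 * real n / (real r - 1)" if "uniform_hypergraph n r H" "linear_hypergraph H" for H
  proof (rule signless_q_le)
    show "q_form n r H x \<le> 2 * real n / (real r - 1)" if "(\<Sum>v<n. \<bar>x v\<bar> ^ r) = 1" for x
      using \<open>uniform_hypergraph n r H\<close> \<open>linear_hypergraph H\<close> assms(2) that by (rule q_form_le_linear)
  qed (use assms in auto)
  show "bdd_above {signless_q n r H | H. uniform_hypergraph n r H \<and> linear_hypergraph H \<and> \<not> contains_expansion V E H}"
  proof (rule bdd_aboveI)
    fix s assume "s \<in> {signless_q n r H | H. uniform_hypergraph n r H \<and> linear_hypergraph H \<and> \<not> contains_expansion V E H}"
    then show "s \<le> 2 * real n / (real r - 1)" using le by (elim CollectE exE conjE) simp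
  qed
qed

theorem ex_lin_q_upper:
  fixes V :: "'a set"
  assumes F: "simple_graph V E" "chromatic_number V E = k + 1" and "E \<noteq> {}" and r: "2 \<le> r" "r \<le> k" and \<epsilon>: "0 < \<epsilon>"
  shows "\<forall>\<^sub>F n in sequentially. ex_lin_q r V E n \<le> 2 * real n / (real r - 1) * (1 - 1 / real k) + \<epsilon> * real n"
proof -
  have k: "2 \<le> k" using r by simp
  define z where "z t = t + r * t^2" for t :: nat
  \<comment> \<open>The least size of the parts for which the greedy embedding is guaranteed to
    leave a choice at every vertex.\<close>
  define T where "T = Suc (z (z (card V)))"
  obtain c where c: "proper_colouring V E c (Suc k)"
    using exists_proper_colouring_chromatic_number[OF F(1)] F(2) by auto
  obtain n0 where n0: "\<forall>n\<ge>n0. \<forall>adj x. (\<forall>u v. adj u v = adj v u) \<and> (\<forall>u. \<not> adj u u) \<and> blowup_free adj (Suc k) T n \<and>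
     (\<forall>v. 0 \<le> x v) \<and> (\<Sum>v<n. (x v)^2) = 1 \<longrightarrow>
    (\<Sum>u<n. \<Sum>v<n. of_bool (adj u v) * (x u + x v)^2) \<le> (4 * (1 - 1 / real k) + 2 * \<epsilon>) * real n"
    using blowup_free_q_form_le[OF k, of "2 * \<epsilon>" T] \<epsilon> by (auto simp: T_def)
  have "ex_lin_q r V E n \<le> 2 * real n / (real r - 1) * (1 - 1 / real k) + \<epsilon> * real n" if n: "n \<ge> max n0 1" for n
  proof (rule ex_lin_q_le[OF \<open>E \<noteq> {}\<close>])
    fix H assume H: "uniform_hypergraph n r H" "linear_hypergraph H" and free: "\<not> contains_expansion V E H"
    have bf: "blowup_free (shadow_adj H) (Suc k) T n"
      unfolding blowup_free_def
    proof (rule notI, elim exE conjE)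
      fix A assume A: "\<forall>i<Suc k. A i \<subseteq> {..<n} \<and> card (A i) = T"
        and adj: "\<forall>i<Suc k. \<forall>j<Suc k. i \<noteq> j \<longrightarrow> (\<forall>a\<in>A i. \<forall>b\<in>A j. shadow_adj H a b)"
      have "contains_expansion V E H"
      proof (rule contains_expansion_of_blowup[OF H r(1) F(1) c z_def])
        fix i assume "i < Suc k"
        then show "finite (A i) \<and> z (z (card V)) < card (A i)"
          using A finite_subset[of "A i" "{..<n}"] by (auto simp: T_def)
      next
        fix i j a b assume "i < Suc k" "j < Suc k" "i \<noteq> j" "a \<in> A i" "b \<in> A j"
        then have "shadow_adj H a b" using adj by blast
        then show "\<exists>h\<in>H. a \<in> h \<and> b \<in> h" by (auto simp: shadow_adj_def)
      qed
      then show False using free by simp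
    qed
    define C where "C = (2 * (1 - 1 / real k) + \<epsilon>) * real n"
    have "signless_q n r H \<le> C / (real r - 1)"
    proof (rule signless_q_le)
      fix x :: "nat \<Rightarrow> real" assume x: "(\<Sum>v<n. \<bar>x v\<bar> ^ r) = 1"
      show "q_form n r H x \<le> C / (real r - 1)"
      proof (rule q_form_le_of_shadow_bound[OF H r(1) _ x])
        fix y :: "nat \<Rightarrow> real" assume y: "\<And>v. 0 \<le> y v" "(\<Sum>v<n. (y v)^2) = 1"
        have sym: "\<forall>u v. shadow_adj H u v = shadow_adj H v u" "\<forall>u. \<not> shadow_adj H u u"
          by (auto simp: shadow_adj_def)
        have "(\<Sum>u<n. \<Sum>v<n. of_bool (shadow_adj H u v) * (y u + y v)^2) \<le> (4 * (1 - 1 / real k) + 2 * \<epsilon>) * real n"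
          using n0[rule_format, of n "shadow_adj H" y] n sym bf y by simp
        also have "\<dots> = 2 * C" by (simp add: C_def algebra_simps)
        finally show "(\<Sum>u<n. \<Sum>v<n. of_bool (shadow_adj H u v) * (y u + y v)^2) \<le> 2 * C" .
      qed
    qed (use n r in auto)
    also have "C / (real r - 1) = 2 * real n / (real r - 1) * (1 - 1 / real k) + \<epsilon> * real n / (real r - 1)"
      by (simp add: C_def add_divide_distrib[symmetric] algebra_simps)
    also have "\<epsilon> * real n / (real r - 1) \<le> \<epsilon> * real n / 1"
      using r \<epsilon> by (intro divide_left_mono) auto
    finally show "signless_q n r H \<le> 2 * real n / (real r - 1) * (1 - 1 / real k) + \<epsilon> * real n" by simp
  qed
  then show ?thesis unfolding eventually_sequentially by blast
qed

text \<open>Both sides count the r-sets of parts with an ordered pair of distinct members. It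
  evaluates (k choose r) / mu in the edge count of the packing.\<close>

lemma choose_mult_pair:
  assumes "2 \<le> r" "r \<le> k"
  shows "real (k choose r) * (real r * (real r - 1)) = real k * (real k - 1) * real ((k - 2) choose (r - 2))"
proof -
  have a: "r * (k choose r) = k * ((k - 1) choose (r - 1))"
    using assms by (intro times_binomial_minus1_eq) auto
  have b: "(r - 1) * ((k - 1) choose (r - 1)) = (k - 1) * ((k - 2) choose (r - 2))"
    using times_binomial_minus1_eq[of "r - 1" "k - 1"] assms by (simp add: numeral_2_eq_2)
  have "(k choose r) * (r * (r - 1)) = (r - 1) * (r * (k choose r))" by simp
  also have "\<dots> = k * ((r - 1) * ((k - 1) choose (r - 1)))" unfolding a by simp
  also have "\<dots> = k * (k - 1) * ((k - 2) choose (r - 2))" unfolding b by simp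
  finally have "(k choose r) * (r * (r - 1)) = k * (k - 1) * ((k - 2) choose (r - 2))" .
  then have "real ((k choose r) * (r * (r - 1))) = real (k * (k - 1) * ((k - 2) choose (r - 2)))" by simp
  then show ?thesis using assms by (simp add: of_nat_diff)
qed

text \<open>For \<open>K = k!\<close> the residue makes \<open>q n\<close> coprime to
  \<open>k!\<close>. Candidates are \<open>K\<close> apart while the ideal side length tends to
  infinity, so their ratio tends to 1. In the limit the square accounts for the vertices left over,
  and the factor with \<open>b = mu\<close> for the rounding in \<open>q div mu\<close>.\<close>

lemma exists_side_lengths:
  fixes k K N :: nat and b :: real
  assumes "0 < k" "0 < K" "0 < N"
  shows "\<exists>q. (\<forall>\<^sub>F n in sequentially. k * q n ^ N \<le> n \<and> 0 < q n \<and> q n mod K = 1 mod K) \<and>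
    (\<lambda>n. ((real k * real (q n) ^ N) / real n)^2 * (1 - b / real (q n))) \<longlonglongrightarrow> 1"
proof -
  define \<rho> where "\<rho> n = root N (real n / real k)" for n
  \<comment> \<open>The largest number congruent to 1 modulo \<open>K\<close> that does not exceed
    \<open>\<rho> n\<close>, once \<open>\<rho> n \<ge> 1\<close>.\<close>
  define q where "q n = K * nat \<lfloor>(\<rho> n - 1) / real K\<rfloor> + 1" for n
  have \<rho>N: "\<rho> n ^ N = real n / real k" for n using assms by (simp add: \<rho>_def)
  have lim: "filterlim \<rho> at_top sequentially"
    unfolding filterlim_at_top
  proof
    fix Z :: real
    have "Z \<le> \<rho> n" if n: "n \<ge> nat \<lceil>real k * \<bar>Z\<bar> ^ N\<rceil>" for n
    proof -
      have "real k * \<bar>Z\<bar> ^ N \<le> real n" using n by linarith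
      then have "\<bar>Z\<bar> ^ N \<le> real n / real k" using assms by (simp add: field_simps)
      then have "root N (\<bar>Z\<bar> ^ N) \<le> \<rho> n" unfolding \<rho>_def using assms by (intro real_root_le_mono) auto
      then show ?thesis using assms by (simp add: real_root_power_cancel)
    qed
    then show "\<forall>\<^sub>F n in sequentially. Z \<le> \<rho> n" unfolding eventually_sequentially by blast
  qed
  have ev: "\<forall>\<^sub>F n in sequentially. real K + 1 \<le> \<rho> n \<and> \<rho> n - real K \<le> real (q n) \<and> real (q n) \<le> \<rho> n"
    using filterlim_at_top[THEN iffD1, OF lim, rule_format, of "real K + 1"]
  proof eventually_elim
    case (elim n)
    define x where "x = (\<rho> n - 1) / real K"
    have "0 \<le> x" using elim by (simp add: x_def)
    then have "real (nat \<lfloor>x\<rfloor>) \<le> x" "x - 1 \<le> real (nat \<lfloor>x\<rfloor>)" by linarith+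
    then have "real K * real (nat \<lfloor>x\<rfloor>) \<le> real K * x" "real K * (x - 1) \<le> real K * real (nat \<lfloor>x\<rfloor>)"
      by (auto intro: mult_left_mono)
    moreover have "real K * x = \<rho> n - 1" using assms by (simp add: x_def)
    moreover have "real (q n) = real K * real (nat \<lfloor>x\<rfloor>) + 1" by (simp add: q_def x_def)
    ultimately show ?case using elim by (simp add: right_diff_distrib)
  qed
  have kq: "k * q n ^ N \<le> n" if "real (q n) \<le> \<rho> n" for n
  proof -
    have "real (q n) ^ N \<le> \<rho> n ^ N" using that by (intro power_mono) auto
    then have "real (k * q n ^ N) \<le> real n" using assms by (simp add: \<rho>N field_simps)
    then show ?thesis by (simp only: of_nat_le_iff)
  qed
  have side: "\<forall>\<^sub>F n in sequentially. k * q n ^ N \<le> n \<and> 0 < q n \<and> q n mod K = 1 mod K"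
    using ev
  proof eventually_elim
    case (elim n)
    have "q n mod K = 1 mod K" unfolding q_def by (rule mod_mult_self4)
    moreover have "0 < q n" by (simp add: q_def)
    ultimately show ?case using kq elim by blast
  qed
  have inv: "(\<lambda>n. c / \<rho> n) \<longlonglongrightarrow> 0" for c :: real
    by (rule tendsto_divide_0[OF tendsto_const filterlim_at_top_imp_at_infinity[OF lim]])
  have ratio: "(\<lambda>n. real (q n) / \<rho> n) \<longlonglongrightarrow> 1"
  proof (rule tendsto_sandwich)
    show "\<forall>\<^sub>F n in sequentially. 1 - real K / \<rho> n \<le> real (q n) / \<rho> n"
      using ev
    proof eventually_elim
      case (elim n)
      then have pos: "0 < \<rho> n" by linarith
      have "(\<rho> n - real K) / \<rho> n \<le> real (q n) / \<rho> n"
        using elim pos by (intro divide_right_mono) auto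
      then show ?case using pos by (simp add: diff_divide_distrib)
    qed
    show "\<forall>\<^sub>F n in sequentially. real (q n) / \<rho> n \<le> 1"
      using ev
    proof eventually_elim
      case (elim n)
      then have "0 < \<rho> n" by linarith
      then show ?case using elim by (simp add: divide_le_eq_1)
    qed
    show "(\<lambda>n. 1 - real K / \<rho> n) \<longlonglongrightarrow> 1" using tendsto_diff[OF tendsto_const inv, of 1] by simp
  qed simp
  have "(\<lambda>n. ((real (q n) / \<rho> n) ^ N)^2 * (1 - (b / \<rho> n) / (real (q n) / \<rho> n))) \<longlonglongrightarrow> (1 ^ N)^2 * (1 - 0 / 1)"
    by (intro tendsto_intros ratio inv) auto
  moreover have "\<forall>\<^sub>F n in sequentially. ((real (q n) / \<rho> n) ^ N)^2 * (1 - (b / \<rho> n) / (real (q n) / \<rho> n)) =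
      ((real k * real (q n) ^ N) / real n)^2 * (1 - b / real (q n))"
    using ev
  proof eventually_elim
    case (elim n)
    have "(real (q n) / \<rho> n) ^ N = real k * real (q n) ^ N / real n"
      by (simp add: power_divide \<rho>N mult.commute)
    moreover have "(b / \<rho> n) / (real (q n) / \<rho> n) = b / real (q n)" using elim by simp
    ultimately show ?case by simp
  qed
  ultimately have "(\<lambda>n. ((real k * real (q n) ^ N) / real n)^2 * (1 - b / real (q n))) \<longlonglongrightarrow> 1"
    by (simp add: filterlim_cong)
  with side show ?thesis by blast
qed

text \<open>With N vertices per part the packing has about (k choose r) N^2 / mu edges, which is
  k(k-1) N^2 / (r(r-1)). As kN is close to n, the constant vector gives about 2(k-1)n / (k(r-1)),
  that is \<open>c0 * n\<close>; a relative error of \<open>\<epsilon> / c0\<close> is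
  affordable.\<close>

theorem ex_lin_q_lower:
  fixes V :: "'a set"
  assumes F: "simple_graph V E" "\<not> (\<exists>c. proper_colouring V E c k)" and r: "2 \<le> r" "r \<le> k" and \<epsilon>: "0 < \<epsilon>"
  shows "\<forall>\<^sub>F n in sequentially. 2 * real n / (real r - 1) * (1 - 1 / real k) - \<epsilon> * real n \<le> ex_lin_q r V E n"
proof -
  define mu where "mu = (k - 2) choose (r - 2)"
  have mu0: "0 < mu" using r by (simp add: mu_def)
  define c0 where "c0 = 2 / (real r - 1) * (1 - 1 / real k)"
  have c0: "0 < c0" "c0 = 2 * (real k - 1) / (real k * (real r - 1))"
    using r by (auto simp: c0_def field_simps)
  obtain d where d: "\<forall>q n. 0 < q \<and> coprime q (fact k) \<and> k * q ^ Suc d \<le> n \<longrightarrow>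
    (\<exists>H col. uniform_hypergraph n r H \<and> linear_hypergraph H \<and> (\<forall>e\<in>H. inj_on col e \<and> col ` e \<subseteq> {..<k}) \<and>
    card H = (k choose r) * q ^ Suc d * q ^ d * (q div mu))"
    using partite_packing[OF r] unfolding mu_def by (elim exE)
  obtain q where q: "\<forall>\<^sub>F n in sequentially. k * q n ^ Suc d \<le> n \<and> 0 < q n \<and> q n mod fact k = 1 mod fact k"
    and lim: "(\<lambda>n. ((real k * real (q n) ^ Suc d) / real n)^2 * (1 - real mu / real (q n))) \<longlonglongrightarrow> 1"
    using exists_side_lengths[of k "fact k" "Suc d" "real mu"] r by auto
  have "\<forall>\<^sub>F n in sequentially. 1 - \<epsilon> / c0 < ((real k * real (q n) ^ Suc d) / real n)^2 * (1 - real mu / real (q n))"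
    using divide_pos_pos[OF \<epsilon> c0(1)] by (intro order_tendstoD(1)[OF lim]) linarith
  then show ?thesis using q eventually_gt_at_top[of 0]
  proof eventually_elim
    case (elim n)
    define m where "m = real (q n)"
    have m: "0 < m" using elim by (simp add: m_def)
    have "coprime (1 mod fact k) (fact k :: nat)" by (subst coprime_mod_left_iff) simp_all
    moreover have "q n mod fact k = 1 mod fact k" using elim(2) by blast
    ultimately have "coprime (q n mod fact k) (fact k)" by (simp only:)
    then have "coprime (q n) (fact k)" by (subst (asm) coprime_mod_left_iff) simp_all
    with elim(2) have "0 < q n \<and> coprime (q n) (fact k) \<and> k * q n ^ Suc d \<le> n" by simp
    from d[rule_format, OF this] obtain H col where H: "uniform_hypergraph n r H" "linear_hypergraph H"
      "\<forall>e\<in>H. inj_on col e \<and> col ` e \<subseteq> {..<k}"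
      "card H = (k choose r) * q n ^ Suc d * q n ^ d * (q n div mu)"
      by (elim exE conjE)
    have "real (q n) < real mu * (real (q n div mu) + 1)"
    proof -
      have "q n < mu * (q n div mu + 1)"
        using dividend_less_times_div[OF mu0, of "q n"] by simp
      then have "real (q n) < real (mu * (q n div mu + 1))" by (simp only: of_nat_less_iff)
      then show ?thesis by (simp add: algebra_simps)
    qed
    then have "m - real mu \<le> real mu * real (q n div mu)" by (simp add: m_def algebra_simps)
    then have "real (k choose r) * m ^ Suc d * m ^ d * (m - real mu) \<le> real (k choose r) * m ^ Suc d * m ^ d * (real mu * real (q n div mu))"
      using m by (intro mult_left_mono) auto
    also have "\<dots> = real mu * real (card H)" by (simp add: H(4) m_def)
    also have "real (k choose r) * m ^ Suc d * m ^ d * (m - real mu) = real (k choose r) * (m ^ Suc d)^2 * (1 - real mu / m)"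
      using m by (simp add: field_simps power2_eq_square)
    finally have "real r * (real r - 1) * (real (k choose r) * (m ^ Suc d)^2 * (1 - real mu / m)) \<le> real r * (real r - 1) * (real mu * real (card H))"
      using r by (intro mult_left_mono) auto
    also have "real r * (real r - 1) * (real (k choose r) * (m ^ Suc d)^2 * (1 - real mu / m)) =
       real mu * (real k * (real k - 1) * (m ^ Suc d)^2 * (1 - real mu / m))"
      using choose_mult_pair[OF r] by (simp add: mu_def mult_ac)
    finally have "real k * (real k - 1) * (m ^ Suc d)^2 * (1 - real mu / m) \<le> real r * (real r - 1) * real (card H)"
      using mu0 by (simp add: mult_ac)
    then have le: "2 / (real n * (real r - 1)) * (real k * (real k - 1) * (m ^ Suc d)^2 * (1 - real mu / m)) \<le>
        2 / (real n * (real r - 1)) * (real r * (real r - 1) * real (card H))"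
      using r by (intro mult_left_mono) auto
    have "c0 * real n - \<epsilon> * real n = c0 * real n * (1 - \<epsilon> / c0)"
      using c0(1) by (simp add: field_simps)
    also have "\<dots> \<le> c0 * real n * (((real k * m ^ Suc d) / real n)^2 * (1 - real mu / m))"
      using elim(1) c0(1) by (intro mult_left_mono) (auto simp: m_def)
    also have "\<dots> = 2 / (real n * (real r - 1)) * (real k * (real k - 1) * (m ^ Suc d)^2 * (1 - real mu / m))"
    proof -
      define R M Y where "R = real r - 1" and "M = m ^ Suc d" and "Y = 1 - real mu / m"
      have "R \<noteq> 0" using r by (simp add: R_def)
      then have "2 * (real k - 1) / (real k * R) * real n * ((real k * M / real n)^2 * Y) =
        2 / (real n * R) * (real k * (real k - 1) * M^2 * Y)"
        using r elim(3) by (simp add: power2_eq_square field_simps)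
      then show ?thesis unfolding c0(2) R_def M_def Y_def .
    qed
    also note le
    also have "2 / (real n * (real r - 1)) * (real r * (real r - 1) * real (card H)) = 2 * real r * real (card H) / real n"
      using r by simp
    also have "\<dots> \<le> signless_q n r H" by (rule signless_q_ge[OF H(1,2) r(1) elim(3)])
    also have "\<dots> \<le> ex_lin_q r V E n"
      using not_contains_expansion_of_partite[OF _ F(2) H(3) F(1)] r elim(3) by (intro ex_lin_q_ge H) auto
    finally have "c0 * real n - \<epsilon> * real n \<le> ex_lin_q r V E n" .
    moreover have "c0 * real n = 2 * real n / (real r - 1) * (1 - 1 / real k)" by (simp add: c0_def)
    ultimately show ?case by simp
  qed
qed

theorem theorem2p17:
  fixes V :: "'a set" and E :: "'a set set" and k r :: nat
  assumes "simple_graph V E"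
    and "chromatic_number V E = k + 1"
    and "2 \<le> r" and "r \<le> k"
  shows "(\<lambda>n. ex_lin_q r V E n - 2 * real n / (real r - 1) * (1 - 1 / real k))
           \<in> o(\<lambda>n. real n)"
proof (rule landau_o.smallI)
  have no: "\<not> (\<exists>c. proper_colouring V E c k)"
    using assms(2) not_less_Least[of k "\<lambda>k. \<exists>c. proper_colouring V E c k"] by (auto simp: chromatic_number_def)
  \<comment> \<open>For an edgeless graph every hypergraph would contain the expansion, and
    \<open>ex_lin_q\<close> would be the supremum of the empty set.\<close>
  have "E \<noteq> {}"
  proof
    assume "E = {}"
    then have "proper_colouring V E (\<lambda>_. 0) k" using assms by (auto simp: proper_colouring_def)
    then show False using no by blast
  qed
  fix c :: real assume "0 < c"
  from ex_lin_q_upper[OF assms(1,2) \<open>E \<noteq> {}\<close> assms(3,4) this] ex_lin_q_lower[OF assms(1) no assms(3,4) this]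
  show "\<forall>\<^sub>F n in sequentially. norm (ex_lin_q r V E n - 2 * real n / (real r - 1) * (1 - 1 / real k)) \<le> c * norm (real n)"
  proof eventually_elim
    case (elim n)
    then show ?case by (simp only: real_norm_def abs_of_nat abs_le_iff) linarith
  qed
qed

end
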